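(* For every integer $n \geq 3$, $$\mathrm{ex}_{\mathcal P}(n,P_4^{\mathrm{ind}})=\begin{cases} 3n-6, & n\leq 6,\\ \left\lfloor\frac{8}{3}(n-2)\right\rfloor+1, & n\geq 7.\end{cases}$$
   Context: All graphs are finite and simple. $P_k$ denotes the path on $k$ vertices. A graph $G$ is $F^{\mathrm{ind}}$-free if it contains no induced subgraph isomorphic to $F$. The induced planar Turán number is $\mathrm{ex}_{\mathcal P}(n,F^{\mathrm{ind}}):=\max\{|E(G)| : G \text{ is an } n\text{-vertex planar graph that is } F^{\mathrm{ind}}\text{-free}\}$. *)

theory Defs
  imports "HOL-Analysis.Analysis" "HOL-Library.Ramsey"
begin

type_synonym 'a sgraph = "'a set \<times> 'a set set"

abbreviation vertices :: "'a sgraph \<Rightarrow> 'a set" where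
  "vertices G \<equiv> fst G"

abbreviation edges :: "'a sgraph \<Rightarrow> 'a set set" where
  "edges G \<equiv> snd G"

definition simple_graph :: "'a sgraph \<Rightarrow> bool" where
  "simple_graph G \<longleftrightarrow> finite (vertices G) \<and> edges G \<subseteq> [vertices G]\<^bsup>2\<^esup>"

definition graph_iso :: "'a sgraph \<Rightarrow> 'b sgraph \<Rightarrow> bool" where
  "graph_iso G H \<longleftrightarrow>
     (\<exists>f. bij_betw f (vertices G) (vertices H) \<and> edges H = (\<lambda>e. f ` e) ` edges G)"

definition induced_subgraph :: "'a sgraph \<Rightarrow> 'a set \<Rightarrow> 'a sgraph" where
  "induced_subgraph G S = (S, {e \<in> edges G. e \<subseteq> S})"

definition induced_free :: "'b sgraph \<Rightarrow> 'a sgraph \<Rightarrow> bool" where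
  "induced_free F G \<longleftrightarrow> \<not> (\<exists>S \<subseteq> vertices G. graph_iso F (induced_subgraph G S))"

text \<open>\<open>path_graph k\<close> has \<open>k\<close> vertices (not \<open>k\<close> edges).\<close>

definition path_graph :: "nat \<Rightarrow> nat sgraph" where
  "path_graph k = ({..<k}, {{i, Suc i} | i. Suc i < k})"

definition arc_interior :: "(real \<Rightarrow> complex) \<Rightarrow> complex set" where
  "arc_interior g = path_image g - {pathstart g, pathfinish g}"

text \<open>
  A drawing in the Euclidean plane, taken to be the type \<^typ>\<open>complex\<close>: the vertices are distinct
  points, each edge is an arc (a homeomorphic image of the unit interval) joining its two ends, and
  the interior of an edge contains no vertex and no point of any other edge.
\<close>

definition plane_drawing ::
    "'a sgraph \<Rightarrow> ('a \<Rightarrow> complex) \<Rightarrow> ('a set \<Rightarrow> real \<Rightarrow> complex) \<Rightarrow> bool" where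
  "plane_drawing G p \<gamma> \<longleftrightarrow>
     inj_on p (vertices G) \<and>
     (\<forall>e \<in> edges G. arc (\<gamma> e) \<and> {pathstart (\<gamma> e), pathfinish (\<gamma> e)} = p ` e) \<and>
     (\<forall>e \<in> edges G. arc_interior (\<gamma> e) \<inter> p ` vertices G = {}) \<and>
     (\<forall>e \<in> edges G. \<forall>f \<in> edges G. e \<noteq> f \<longrightarrow> arc_interior (\<gamma> e) \<inter> path_image (\<gamma> f) = {})"

definition planar_graph :: "'a sgraph \<Rightarrow> bool" where
  "planar_graph G \<longleftrightarrow> (\<exists>p \<gamma>. plane_drawing G p \<gamma>)"

text \<open>
  Every finite graph is isomorphic to one whose vertices are natural numbers, so it suffices to
  let the host graph range over these.
\<close>

definition ex_planar_ind_edge_counts :: "nat \<Rightarrow> 'b sgraph \<Rightarrow> nat set" where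
  "ex_planar_ind_edge_counts n F =
     {card (edges G) | G :: nat sgraph.
        simple_graph G \<and> card (vertices G) = n \<and> planar_graph G \<and> induced_free F G}"

definition ex_planar_ind :: "nat \<Rightarrow> 'b sgraph \<Rightarrow> nat" where
  "ex_planar_ind n F = Max (ex_planar_ind_edge_counts n F)"

text \<open>
  The maximum is over a finite set, which for \<open>P\<^sub>4\<close> is also nonempty, so \<^const>\<open>Max\<close> is
  the genuine maximum.
\<close>

lemma finite_ex_planar_ind_edge_counts: "finite (ex_planar_ind_edge_counts n F)"
proof (rule finite_subset)
  show "ex_planar_ind_edge_counts n F \<subseteq> {..n choose 2}"
  proof
    fix m assume "m \<in> ex_planar_ind_edge_counts n F"
    then obtain G :: "nat sgraph" where G: "simple_graph G" "card (vertices G) = n"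
      and m: "m = card (edges G)"
      unfolding ex_planar_ind_edge_counts_def by blast
    have "card (edges G) \<le> card ([vertices G]\<^bsup>2\<^esup>)"
      using G by (intro card_mono) (auto simp: simple_graph_def finite_imp_finite_nsets)
    with G m show "m \<in> {..n choose 2}" by simp
  qed
qed simp

lemma ex_planar_ind_edge_counts_P4_nonempty: "ex_planar_ind_edge_counts n (path_graph 4) \<noteq> {}"
proof -
  let ?G = "({..<n}, {}) :: nat sgraph"
  have "plane_drawing ?G of_nat g" for g
    by (auto simp: plane_drawing_def inj_on_def)
  then have "planar_graph ?G" unfolding planar_graph_def by blast
  moreover have "edges (path_graph 4) \<noteq> {}"
    by (auto simp: path_graph_def intro: exI[of _ 0])
  then have "induced_free (path_graph 4) ?G"
    by (auto simp: induced_free_def graph_iso_def induced_subgraph_def)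
  moreover have "simple_graph ?G" "card (vertices ?G) = n"
    by (simp_all add: simple_graph_def)
  ultimately show ?thesis
    unfolding ex_planar_ind_edge_counts_def by blast
qed

end

theory Submission
  imports Defs
begin

text \<open>
  A \<open>P\<^sub>4\<close>-free graph on at least two vertices is a disjoint union or a join of two smaller ones.
  The upper bound follows by induction along this decomposition, using only that \<open>K\<^sub>5\<close>,
  \<open>K\<^sub>3\<^sub>,\<^sub>3\<close> and their subdivisions at one edge are not planar.  In a join of at least seven
  vertices one side has at most two.  If it is a pair, the other side contains no claw, triangle or
  4-cycle, hence is a union of paths on at most three vertices; if it is a single vertex over a
  disjoint union, then the graph is glued from two smaller ones at that vertex.  The bound is
  attained by joining an edge to disjoint copies of \<open>P\<^sub>3\<close>, and by the octahedron when \<open>n = 6\<close>.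
\<close>

section \<open>Arcs and theta graphs\<close>

text \<open>The constant 8/3 counts two edges from each outer vertex to the central pair and two
  thirds of an edge inside the copies of \<open>P\<^sub>3\<close>; the final 1 is the edge of the
  pair. The octahedron exceeds this value, so the induction carries two bounds: with e edges on n
  vertices, 3e + 12 \<le> 8n for all n \<ge> 2, attained by the octahedron, and 3e + 13 \<le> 8n
  from n = 7 on. Gluing at a vertex costs 8 but brings in 12 twice, so the weak bound for the pieces
  yields the strong one with room to spare; only the join with a pair is tight. A further vertex w
  of the other side supplies the path a w b instead, which is where subdivisions at one edge enter;
  five vertices on that side guarantee w. Up to six vertices the missing edges are counted without
  any decomposition. Nonplanarity itself is topological: \<open>K\<^sub>5\<close> and
  \<open>K\<^sub>3\<^sub>,\<^sub>3\<close> both reduce to the fact that no point sees all three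
  paths of a theta graph.\<close>

definition arc_between :: "complex set \<Rightarrow> complex \<Rightarrow> complex \<Rightarrow> bool" where
  "arc_between P a b \<longleftrightarrow> (\<exists>g. arc g \<and> path_image g = P \<and> pathstart g = a \<and> pathfinish g = b)"

lemma arc_between_commute: "arc_between P a b \<longleftrightarrow> arc_between P b a"
proof -
  have "arc_between P b a" if "arc_between P a b" for a b
  proof -
    obtain g where "arc g" "path_image g = P" "pathstart g = a" "pathfinish g = b"
      using \<open>arc_between P a b\<close> by (auto simp: arc_between_def)
    then show ?thesis
      unfolding arc_between_def by (intro exI[of _ "reversepath g"]) (simp add: arc_reversepath)
  qed
  then show ?thesis by blast
qed

text \<open>Working with images rather than parametrisations lets a path through a vertex be the
  plain union of two edge arcs.\<close>

lemma arc_between_join: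
  assumes "arc_between P a b" "arc_between Q b c" "P \<inter> Q \<subseteq> {b}"
  shows "arc_between (P \<union> Q) a c"
proof -
  obtain g h where "arc g" "path_image g = P" "pathstart g = a" "pathfinish g = b"
    "arc h" "path_image h = Q" "pathstart h = b" "pathfinish h = c"
    using assms by (auto simp: arc_between_def)
  then show ?thesis
    unfolding arc_between_def using assms(3)
    by (intro exI[of _ "g +++ h"]) (simp add: arc_join path_image_join)
qed

lemma
  assumes "arc_between P a b"
  shows arc_between_ends: "a \<in> P" "b \<in> P" "a \<noteq> b"
    and compact_arc_between: "compact P"
    and connected_arc_between: "connected P"
    and connected_arc_between_interior: "connected (P - {a, b})"
proof -
  obtain g where g: "arc g" "path_image g = P" "pathstart g = a" "pathfinish g = b"
    using assms by (auto simp: arc_between_def)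
  show "a \<in> P" "b \<in> P" using g by auto
  show "a \<noteq> b" using g by (metis arc_distinct_ends)
  show "compact P" "connected P" using g compact_arc_image connected_arc_image by blast+
  show "connected (P - {a, b})"
    using g connected_simple_path_endless[of g] arc_imp_simple_path by metis
qed

text \<open>The set is the image of a half-open interval. It serves to move along an edge towards
  one end while avoiding the other.\<close>

lemma connected_arc_between_minus_start:
  assumes "arc_between P a b"
  shows "connected (P - {a})"
proof -
  obtain g where g: "arc g" "path_image g = P" "pathstart g = a"
    using assms by (auto simp: arc_between_def)
  have "continuous_on {0<..1} g"
    using arc_imp_path[OF g(1)] unfolding path_def by (rule continuous_on_subset) auto
  then have "connected (g ` {0<..1})"
    by (intro connected_continuous_image) auto
  moreover have "g ` {0<..1} = P - {a}"
  proof -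
    have "g ` ({0..1} - {0}) = g ` {0..1} - g ` {0}"
      using g(1) by (intro inj_on_image_set_diff[of g "{0..1}"]) (auto simp: arc_def)
    moreover have "{0..1} - {0} = {0<..1::real}" by auto
    ultimately show ?thesis using g by (auto simp: path_image_def pathstart_def)
  qed
  ultimately show ?thesis by simp
qed

lemma connected_arc_between_minus_finish:
  "arc_between P a b \<Longrightarrow> connected (P - {b})"
  using connected_arc_between_minus_start arc_between_commute by blast

lemma Jordan_two_arcs:
  assumes "arc_between P a b" "arc_between Q a b" "P \<inter> Q \<subseteq> {a, b}"
  obtains U W where "open U" "connected U" "open W" "connected W" "W \<noteq> {}" "U \<noteq> {}"
    "U \<inter> W = {}" "U \<union> W = - (P \<union> Q)" "frontier U = P \<union> Q" "frontier W = P \<union> Q"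
proof -
  obtain g where g: "arc g" "path_image g = P" "pathstart g = a" "pathfinish g = b"
    using assms by (auto simp: arc_between_def)
  obtain h where h: "arc h" "path_image h = Q" "pathstart h = b" "pathfinish h = a"
    using assms(2) arc_between_commute[of Q a b] by (auto simp: arc_between_def)
  have "simple_path (g +++ h)"
    using g h assms(3) by (intro simple_path_join_loop) auto
  moreover have "path_image (g +++ h) = P \<union> Q"
    using g h by (simp add: path_image_join)
  moreover have "pathfinish (g +++ h) = pathstart (g +++ h)"
    using g h by simp
  ultimately show thesis
    using Jordan_curve[of "g +++ h" thesis] that by simp
qed

lemma connected_subset_side:
  assumes "open U" "open W" "U \<inter> W = {}" "U \<union> W = - C" "connected K" "K \<inter> C = {}"
    "x \<in> K" "x \<in> U"
  shows "K \<subseteq> U"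
proof -
  have "K \<subseteq> U \<union> W" using assms by auto
  then have "U \<inter> K = {} \<or> W \<inter> K = {}"
    using connectedD[OF \<open>connected K\<close> \<open>open U\<close> \<open>open W\<close>] assms by blast
  then show ?thesis using assms by blast
qed

text \<open>No point can see all three paths of a theta graph: the side of \<open>P2 \<union> P3\<close> not containing
  \<open>m\<close> borders both \<open>P2\<close> and \<open>P3\<close>, so neither \<open>P1 \<union> P2\<close> nor \<open>P1 \<union> P3\<close> separates it from
  \<open>m\<close>, and by Janiszewski's theorem neither does the whole theta graph.\<close>

lemma theta_graph_blocks:
  assumes arcs: "arc_between P1 a b" "arc_between P2 a b" "arc_between P3 a b"
    and disj: "P1 \<inter> P2 \<subseteq> {a, b}" "P1 \<inter> P3 \<subseteq> {a, b}" "P2 \<inter> P3 \<subseteq> {a, b}"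
    and q1: "q1 \<in> P1 - {a, b}" "connected_component (- (P2 \<union> P3)) m q1"
    and q2: "q2 \<in> P2 - {a, b}" "connected_component (- (P1 \<union> P3)) m q2"
    and q3: "q3 \<in> P3 - {a, b}" "connected_component (- (P1 \<union> P2)) m q3"
  shows False
proof -
  have "\<exists>U W. open U \<and> connected U \<and> open W \<and> connected W \<and> W \<noteq> {} \<and> m \<in> U \<and>
     U \<inter> W = {} \<and> U \<union> W = - (P2 \<union> P3) \<and> frontier W = P2 \<union> P3"
  proof -
    have m: "m \<in> - (P2 \<union> P3)" using q1 connected_component_in by blast
    obtain U W where "open U" "connected U" "open W" "connected W" "W \<noteq> {}" "U \<noteq> {}"
      "U \<inter> W = {}" "U \<union> W = - (P2 \<union> P3)" "frontier U = P2 \<union> P3" "frontier W = P2 \<union> P3"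
      using Jordan_two_arcs[OF arcs(2,3) disj(3)] by blast
    then show ?thesis using m by (metis Int_commute Un_commute Un_iff)
  qed
  then obtain U W where UW: "open U" "connected U" "open W" "connected W" "W \<noteq> {}" "m \<in> U"
     "U \<inter> W = {}" "U \<union> W = - (P2 \<union> P3)" "frontier W = P2 \<union> P3"
    by blast
  note side = connected_subset_side[OF UW(1,3,7,8)]
  \<comment> \<open>The point \<open>q1\<close> pulls the whole interior of \<open>P1\<close> to the
    side of \<open>m\<close>, so the other side \<open>W\<close> misses \<open>P1\<close>.\<close>
  have "q1 \<in> U"
    using q1(2) UW(6) side unfolding connected_component_def by blast
  then have "P1 - {a, b} \<subseteq> U"
    using side[OF connected_arc_between_interior[OF arcs(1)]] q1(1) disj by blast
  moreover have "a \<in> P2" "b \<in> P2" using arc_between_ends[OF arcs(2)] by auto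
  ultimately have WP1: "W \<inter> P1 = {}" using UW by blast
  obtain y where y: "y \<in> W" using UW(5) by blast
  \<comment> \<open>\<open>Q\<close> is the path left out of the cycle \<open>P1 \<union> P\<close>.
    Its interior borders \<open>W\<close>, so together they form a connected set off that cycle,
    which contains both \<open>q\<close> and \<open>y\<close>.\<close>
  have reach: "connected_component (- (P1 \<union> P)) m y"
    if P: "P \<union> Q = P2 \<union> P3" "Q \<inter> (P1 \<union> P) \<subseteq> {a, b}" "q \<in> Q - {a, b}"
      and q: "connected_component (- (P1 \<union> P)) m q" for P Q q
  proof -
    let ?K = "W \<union> (Q - {a, b})"
    have "closure W = W \<union> (P2 \<union> P3)" using UW(9) closure_Un_frontier by metis
    then have "connected ?K"
      using P(1) by (intro connected_intermediate_closure[OF UW(4)]) auto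
    moreover have "?K \<subseteq> - (P1 \<union> P)" using UW(8) WP1 P by blast
    ultimately have "connected_component (- (P1 \<union> P)) q y"
      unfolding connected_component_def using y P by blast
    then show ?thesis using q connected_component_trans by blast
  qed
  have "connected_component (- ((P1 \<union> P2) \<union> (P1 \<union> P3))) m y"
  proof (rule Janiszewski)
    show "compact (P1 \<union> P2)" "closed (P1 \<union> P3)"
      using compact_arc_between arcs by (blast intro: compact_Un compact_imp_closed)+
    \<comment> \<open>Janiszewski's theorem needs a connected intersection; here it is the single
      arc \<open>P1\<close>.\<close>
    have "(P1 \<union> P2) \<inter> (P1 \<union> P3) = P1"
      using disj arc_between_ends[OF arcs(1)] by blast
    then show "connected ((P1 \<union> P2) \<inter> (P1 \<union> P3))"
      using connected_arc_between[OF arcs(1)] by simp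
    show "connected_component (- (P1 \<union> P2)) m y"
      by (rule reach[of _ P3 q3]) (use q3 disj in auto)
    show "connected_component (- (P1 \<union> P3)) m y"
      by (rule reach[of _ P2 q2]) (use q2 disj in auto)
  qed
  then obtain K where "connected K" "K \<subseteq> - ((P1 \<union> P2) \<union> (P1 \<union> P3))" "m \<in> K" "y \<in> K"
    unfolding connected_component_def by blast
  then have "K \<subseteq> U" using side[of K m] UW(6) by blast
  then show False using \<open>y \<in> K\<close> y UW by blast
qed

lemma connected_componentI2:
  "connected K \<Longrightarrow> K \<inter> C = {} \<Longrightarrow> x \<in> K \<Longrightarrow> y \<in> K \<Longrightarrow> connected_component (- C) x y"
  unfolding connected_component_def by blast

section \<open>Edges as vertex pairs, and a criterion for plane drawings\<close>

lemma edge_doubleton: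
  assumes "simple_graph G" "{u, v} \<in> edges G"
  shows "u \<in> vertices G" "v \<in> vertices G" "u \<noteq> v"
proof -
  have "{u, v} \<in> [vertices G]\<^bsup>2\<^esup>" using assms unfolding simple_graph_def by blast
  then show "u \<in> vertices G" "v \<in> vertices G" "u \<noteq> v" by simp_all
qed

lemma simple_graph_edgeE:
  assumes "simple_graph G" "e \<in> edges G"
  obtains u v where "e = {u, v}" "u \<in> vertices G" "v \<in> vertices G" "u \<noteq> v"
  using assms nsets2_E[of e "vertices G"] by (auto simp: simple_graph_def)

text \<open>Arc interiors are replaced by whole images that meet in common ends only, the form in
  which segments and rerouted edges come.\<close>

lemma plane_drawingI:
  assumes "inj_on p (vertices G)"
    and "\<And>e. e \<in> edges G \<Longrightarrow> e \<subseteq> vertices G"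
    and "\<And>e. e \<in> edges G \<Longrightarrow> arc (\<gamma> e) \<and> {pathstart (\<gamma> e), pathfinish (\<gamma> e)} = p ` e"
    and "\<And>e w. e \<in> edges G \<Longrightarrow> w \<in> vertices G \<Longrightarrow> p w \<in> path_image (\<gamma> e) \<Longrightarrow> w \<in> e"
    and "\<And>e f. e \<in> edges G \<Longrightarrow> f \<in> edges G \<Longrightarrow> e \<noteq> f \<Longrightarrow>
      path_image (\<gamma> e) \<inter> path_image (\<gamma> f) \<subseteq> p ` (e \<inter> f)"
  shows "plane_drawing G p \<gamma>"
proof -
  have "arc_interior (\<gamma> e) = path_image (\<gamma> e) - p ` e" if "e \<in> edges G" for e
    using assms(3)[OF that] by (auto simp: arc_interior_def)
  then have int: "z \<in> path_image (\<gamma> e)" "z \<notin> p ` e" if "e \<in> edges G" "z \<in> arc_interior (\<gamma> e)" for e z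
    using that by auto
  have "arc_interior (\<gamma> e) \<inter> p ` vertices G = {}" if "e \<in> edges G" for e
    using int[OF that] assms(4)[OF that] by blast
  moreover have "arc_interior (\<gamma> e) \<inter> path_image (\<gamma> f) = {}"
    if "e \<in> edges G" "f \<in> edges G" "e \<noteq> f" for e f
    using int[OF that(1)] assms(5)[OF that] by blast
  ultimately show ?thesis
    using assms(1,3) unfolding plane_drawing_def by blast
qed

section \<open>Nonplanarity of complete and complete bipartite graphs\<close>

locale drawing =
  fixes G :: "'a sgraph" and p :: "'a \<Rightarrow> complex" and \<gamma>
  assumes simple: "simple_graph G" and drawing: "plane_drawing G p \<gamma>"
begin

definition edge_arc :: "'a \<Rightarrow> 'a \<Rightarrow> complex set" where
  "edge_arc u v = path_image (\<gamma> {u, v})"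

lemma inj_p: "u \<in> vertices G \<Longrightarrow> v \<in> vertices G \<Longrightarrow> p u = p v \<longleftrightarrow> u = v"
  using drawing by (auto simp: plane_drawing_def inj_on_def)

lemma edge_arc_commute: "edge_arc u v = edge_arc v u"
  by (simp add: edge_arc_def insert_commute)

lemma arc_between_edge_arc:
  assumes e: "{u, v} \<in> edges G"
  shows "arc_between (edge_arc u v) (p u) (p v)"
proof -
  have "arc (\<gamma> {u, v})" "{pathstart (\<gamma> {u, v}), pathfinish (\<gamma> {u, v})} = {p u, p v}"
    using drawing e by (auto simp: plane_drawing_def)
  then have "arc_between (edge_arc u v) (p u) (p v) \<or> arc_between (edge_arc u v) (p v) (p u)"
    unfolding arc_between_def edge_arc_def by (auto simp: doubleton_eq_iff)
  then show ?thesis using arc_between_commute by blast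
qed

lemma vertex_on_edge:
  assumes e: "e \<in> edges G" and w: "w \<in> vertices G" and "p w \<in> path_image (\<gamma> e)"
  shows "w \<in> e"
proof -
  have "arc_interior (\<gamma> e) \<inter> p ` vertices G = {}"
    "{pathstart (\<gamma> e), pathfinish (\<gamma> e)} = p ` e"
    using drawing e by (auto simp: plane_drawing_def)
  then have "p w \<in> p ` e" using assms(3) w by (auto simp: arc_interior_def)
  moreover have "e \<subseteq> vertices G" using simple e by (auto simp: simple_graph_def nsets_def)
  ultimately show ?thesis using inj_p w by blast
qed

lemma edges_meet_at_ends:
  assumes e: "e \<in> edges G" and f: "f \<in> edges G" "e \<noteq> f"
  shows "path_image (\<gamma> e) \<inter> path_image (\<gamma> f) \<subseteq> p ` (e \<inter> f)"
proof
  fix z assume z: "z \<in> path_image (\<gamma> e) \<inter> path_image (\<gamma> f)"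
  have *: "{pathstart (\<gamma> e), pathfinish (\<gamma> e)} = p ` e"
    "{pathstart (\<gamma> f), pathfinish (\<gamma> f)} = p ` f"
    "arc_interior (\<gamma> e) \<inter> path_image (\<gamma> f) = {}"
    using drawing e f by (auto simp: plane_drawing_def)
  then have "z \<in> p ` e" using z by (auto simp: arc_interior_def)
  then obtain w where w: "w \<in> e" "z = p w" by blast
  then have "w \<in> vertices G" using simple e by (auto simp: simple_graph_def nsets_def)
  then have "w \<in> f" using vertex_on_edge f z w by blast
  then show "z \<in> p ` (e \<inter> f)" using w by blast
qed

lemma edge_arcs_meet:
  assumes "{u, v} \<in> edges G" "{x, y} \<in> edges G" "{u, v} \<noteq> {x, y}"
  shows "edge_arc u v \<inter> edge_arc x y \<subseteq> p ` ({u, v} \<inter> {x, y})"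
  using edges_meet_at_ends[OF assms] by (simp add: edge_arc_def)

lemma edge_arcs_adjacent:
  assumes "{u, v} \<in> edges G" "{v, y} \<in> edges G" "u \<noteq> y"
  shows "edge_arc u v \<inter> edge_arc v y \<subseteq> {p v}"
  using edge_arcs_meet[OF assms(1,2)] assms edge_doubleton[OF simple] by (auto simp: doubleton_eq_iff)

lemma edge_arcs_disjoint:
  assumes "{u, v} \<in> edges G" "{x, y} \<in> edges G" "u \<noteq> x" "u \<noteq> y" "v \<noteq> x" "v \<noteq> y"
  shows "edge_arc u v \<inter> edge_arc x y = {}"
  using edge_arcs_meet[OF assms(1,2)] assms by (auto simp: doubleton_eq_iff)

lemma arc_between_two_edges:
  assumes "{u, v} \<in> edges G" "{v, w} \<in> edges G" "u \<noteq> w"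
  shows "arc_between (edge_arc u v \<union> edge_arc v w) (p u) (p w)"
  by (rule arc_between_join[OF arc_between_edge_arc[OF assms(1)] arc_between_edge_arc[OF assms(2)]
        edge_arcs_adjacent[OF assms]])

text \<open>The paths from a1 to a2 through the three vertices of \<open>B\<close> form a theta
  graph, and a3 sees an inner point of each along its own edges.\<close>

lemma no_K33:
  assumes "card A = 3" "card B = 3"
    and E: "\<And>a b. a \<in> A \<Longrightarrow> b \<in> B \<Longrightarrow> {a, b} \<in> edges G"
  shows False
proof -
  obtain a1 a2 a3 where A: "A = {a1, a2, a3}" "a1 \<noteq> a2" "a1 \<noteq> a3" "a2 \<noteq> a3"
    using assms by (auto simp: card_3_iff)
  obtain b1 b2 b3 where B: "B = {b1, b2, b3}" "b1 \<noteq> b2" "b1 \<noteq> b3" "b2 \<noteq> b3"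
    using assms by (auto simp: card_3_iff)
  have a: "a1 \<in> A" "a2 \<in> A" "a3 \<in> A" and b: "b1 \<in> B" "b2 \<in> B" "b3 \<in> B" using A B by auto
  have E': "{b, a} \<in> edges G" if "a \<in> A" "b \<in> B" for a b
    using E[OF that] by (simp add: insert_commute)
  have V: "a \<in> vertices G" "b \<in> vertices G" "a \<noteq> b" if "a \<in> A" "b \<in> B" for a b
    using edge_doubleton[OF simple E[OF that]] by auto
  have D0: "edge_arc a b \<inter> edge_arc a' b' = {}"
    if "a \<in> A" "b \<in> B" "a' \<in> A" "b' \<in> B" "a \<noteq> a'" "b \<noteq> b'" for a b a' b'
    using edge_arcs_disjoint[OF E[OF that(1,2)] E[OF that(3,4)] that(5) V(3)[OF that(1,4)] _ that(6)]
      V(3)[OF that(3,2)] by simp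
  have Da: "edge_arc a b \<inter> edge_arc a b' \<subseteq> {p a}"
    if "a \<in> A" "b \<in> B" "b' \<in> B" "b \<noteq> b'" for a b b'
    using edge_arcs_adjacent[OF E'[OF that(1,2)] E[OF that(1,3)] that(4)]
    by (simp add: edge_arc_commute)
  let ?P = "\<lambda>b. edge_arc a1 b \<union> edge_arc a2 b"
  have arcs: "arc_between (?P b) (p a1) (p a2)" if "b \<in> B" for b
    using arc_between_two_edges[OF E[OF a(1) that] E'[OF a(2) that] A(2)]
    by (simp add: edge_arc_commute)
  have disj: "?P b \<inter> ?P c \<subseteq> {p a1, p a2}" if "b \<in> B" "c \<in> B" "b \<noteq> c" for b c
    using Da[OF a(1) that] Da[OF a(2) that] D0[OF a(1) that(1) a(2) that(2) A(2) that(3)]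
      D0[OF a(2) that(1) a(1) that(2) _ that(3)] A(2) by blast
  have ends: "p a \<in> edge_arc a b" "p b \<in> edge_arc a b" if "a \<in> A" "b \<in> B" for a b
    using arc_between_ends[OF arc_between_edge_arc[OF E[OF that]]] by auto
  have int: "p b \<in> ?P b - {p a1, p a2}" if "b \<in> B" for b
    using ends[OF a(1) that] inj_p[of b a1] inj_p[of b a2] V[OF a(1) that] V[OF a(2) that] by auto
  have con: "connected_component (- (?P b \<union> ?P c)) (p a3) (p d)"
    if "b \<in> B" "c \<in> B" "d \<in> B" "b \<noteq> d" "c \<noteq> d" for b c d
  proof (rule connected_componentI2)
    show "connected (edge_arc a3 d)" "p a3 \<in> edge_arc a3 d" "p d \<in> edge_arc a3 d"
      using connected_arc_between[OF arc_between_edge_arc] E[OF a(3) that(3)] ends[OF a(3) that(3)]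
      by blast+
    show "edge_arc a3 d \<inter> (?P b \<union> ?P c) = {}"
      using D0[OF a(3) that(3) a(1) that(1)] D0[OF a(3) that(3) a(1) that(2)]
        D0[OF a(3) that(3) a(2) that(1)] D0[OF a(3) that(3) a(2) that(2)] A that by blast
  qed
  show False
    using theta_graph_blocks[OF arcs[OF b(1)] arcs[OF b(2)] arcs[OF b(3)]
        disj[OF b(1,2) B(2)] disj[OF b(1,3) B(3)] disj[OF b(2,3) B(4)]
        int[OF b(1)] con[OF b(2,3,1)] int[OF b(2)] con[OF b(1,3,2)] int[OF b(3)] con[OF b(1,2,3)]]
      B by simp
qed

text \<open>The interior of the chord \<open>xy\<close>, the interior of the chord \<open>az\<close> and the fifth vertex \<open>b\<close>
  avoid the 4-cycle \<open>x a y z\<close>, so two of the three lie on the same side of it.  In each case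
  one of the chords completes the cycle to a theta graph all of whose paths are seen from one point.\<close>

lemma no_K5:
  assumes "card S = 5"
    and E: "\<And>u v. u \<in> S \<Longrightarrow> v \<in> S \<Longrightarrow> u \<noteq> v \<Longrightarrow> {u, v} \<in> edges G"
  shows False
proof -
  obtain x y z a b where S: "S = {x, y, z, a, b}" and dist: "distinct [x, y, z, a, b]"
  proof -
    obtain xs where xs: "set xs = S" "distinct xs"
      using finite_distinct_list[of S] \<open>card S = 5\<close> by (metis card.infinite zero_neq_numeral)
    then have "length xs = 5" using distinct_card[of xs] \<open>card S = 5\<close> by simp
    then obtain x y z a b where "xs = [x, y, z, a, b]"
      by (auto simp: eval_nat_numeral length_Suc_conv)
    with xs that show thesis by auto
  qed
  have mem: "x \<in> S" "y \<in> S" "z \<in> S" "a \<in> S" "b \<in> S" using S by auto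
  define C where "C = edge_arc x a \<union> edge_arc a y \<union> (edge_arc x z \<union> edge_arc z y)"
  have A2: "arc_between (edge_arc u v \<union> edge_arc v w) (p u) (p w)"
    if "u \<in> S" "v \<in> S" "w \<in> S" "distinct [u, v, w]" for u v w
    by (rule arc_between_two_edges) (use E that in auto)
  have A1: "arc_between (edge_arc u v) (p u) (p v)" if "u \<in> S" "v \<in> S" "u \<noteq> v" for u v
    using E that arc_between_edge_arc by blast
  have D0: "edge_arc u v \<inter> edge_arc s t = {}"
    if "u \<in> S" "v \<in> S" "s \<in> S" "t \<in> S" "distinct [u, v, s, t]" for u v s t
    by (rule edge_arcs_disjoint) (use E that in auto)
  have D1: "edge_arc u v \<inter> edge_arc v t \<subseteq> {p v}"
    if "u \<in> S" "v \<in> S" "t \<in> S" "distinct [u, v, t]" for u v t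
    by (rule edge_arcs_adjacent) (use E that in auto)
  have V: "u \<in> vertices G" if "u \<in> S" for u
  proof -
    have "\<exists>v. v \<in> S \<and> v \<noteq> u" using mem dist by (metis distinct_length_2_or_more)
    then show ?thesis using E that edge_doubleton[OF simple] by blast
  qed
  have pne: "p u \<noteq> p v" if "u \<in> S" "v \<in> S" "u \<noteq> v" for u v
    using inj_p that V by blast
  have ends: "p u \<in> edge_arc u v" "p v \<in> edge_arc u v" if "u \<in> S" "v \<in> S" "u \<noteq> v" for u v
    using arc_between_ends[OF A1[OF that]] by auto
  have V0: "p w \<notin> edge_arc u v" if "u \<in> S" "v \<in> S" "w \<in> S" "distinct [u, v, w]" for u v w
    using vertex_on_edge[of "{u, v}" w] E that V unfolding edge_arc_def by auto
  \<comment> \<open>Adding the chord st to the 4-cycle \<open>C\<close> through s, u, t, v gives a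
    theta graph; \<open>m\<close> sees \<open>q\<close> on the chord and the middle vertices u and v
    of the other two paths.\<close>
  have chord: False
    if d: "distinct [s, t, u, v]" and S: "s \<in> S" "t \<in> S" "u \<in> S" "v \<in> S"
      and C: "C = (edge_arc s u \<union> edge_arc u t) \<union> (edge_arc s v \<union> edge_arc v t)"
      and q: "q \<in> edge_arc s t - {p s, p t}" "connected_component (- C) m q"
      and m: "connected_component (- (edge_arc s t \<union> (edge_arc s v \<union> edge_arc v t))) m (p u)"
        "connected_component (- (edge_arc s t \<union> (edge_arc s u \<union> edge_arc u t))) m (p v)"
    for s t u v q m
  proof -
    note D = D0[OF S(1,3,4,2)] D0[OF S(3,2,1,4)] D1[OF S(3,1,4)] D1[OF S(3,2,4)]
      D1[OF S(2,1,3)] D1[OF S(1,2,3)] D1[OF S(2,1,4)] D1[OF S(1,2,4)]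
    show False
    proof (rule theta_graph_blocks[of "edge_arc s t" "p s" "p t" "edge_arc s u \<union> edge_arc u t"
        "edge_arc s v \<union> edge_arc v t" q m "p u" "p v"])
      show "arc_between (edge_arc s t) (p s) (p t)"
        "arc_between (edge_arc s u \<union> edge_arc u t) (p s) (p t)"
        "arc_between (edge_arc s v \<union> edge_arc v t) (p s) (p t)"
        using A1 A2 S d by auto
      show "edge_arc s t \<inter> (edge_arc s u \<union> edge_arc u t) \<subseteq> {p s, p t}"
        "edge_arc s t \<inter> (edge_arc s v \<union> edge_arc v t) \<subseteq> {p s, p t}"
        "(edge_arc s u \<union> edge_arc u t) \<inter> (edge_arc s v \<union> edge_arc v t) \<subseteq> {p s, p t}"
        using D d by (auto simp: edge_arc_commute)
      show "q \<in> edge_arc s t - {p s, p t}" by fact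
      show "connected_component (- (edge_arc s u \<union> edge_arc u t \<union> (edge_arc s v \<union> edge_arc v t))) m q"
        using q(2) C by simp
      show "p u \<in> edge_arc s u \<union> edge_arc u t - {p s, p t}"
        "p v \<in> edge_arc s v \<union> edge_arc v t - {p s, p t}"
        using ends S d pne by auto
      show "connected_component (- (edge_arc s t \<union> (edge_arc s v \<union> edge_arc v t))) m (p u)"
        "connected_component (- (edge_arc s t \<union> (edge_arc s u \<union> edge_arc u t))) m (p v)"
        by fact+
    qed
  qed
  \<comment> \<open>The same 4-cycle read from a to z, so that \<open>chord\<close> also applies to
    the other diagonal.\<close>
  have C': "C = edge_arc a x \<union> edge_arc x z \<union> (edge_arc a y \<union> edge_arc y z)"
    by (auto simp: C_def edge_arc_commute)
  have "\<exists>q. q \<in> edge_arc u v - {p u, p v}" if uv: "u \<in> S" "v \<in> S" "u \<noteq> v" for u v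
  proof -
    obtain g where "arc g" "edge_arc u v = path_image g" "p u = pathstart g" "p v = pathfinish g"
      using A1[OF uv] by (auto simp: arc_between_def)
    then show ?thesis
      using nonempty_simple_path_endless[of g] arc_imp_simple_path by auto
  qed
  then obtain q m where q: "q \<in> edge_arc x y - {p x, p y}" and m: "m \<in> edge_arc a z - {p a, p z}"
    using mem dist by (metis distinct_length_2_or_more)
  have qC: "(edge_arc x y - {p x, p y}) \<inter> C = {}"
    using D1[of x y a] D1[of x y z] D1[of y x a] D1[of y x z] dist mem
    unfolding C_def by (auto simp: edge_arc_commute)
  have mC: "(edge_arc a z - {p a, p z}) \<inter> C = {}"
    using D1[of a z x] D1[of a z y] D1[of z a x] D1[of z a y] dist mem
    unfolding C_def by (auto simp: edge_arc_commute)
  have bC: "p b \<notin> C"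
    using V0[of x a b] V0[of a y b] V0[of x z b] V0[of z y b] dist mem unfolding C_def by auto
  have star: "connected_component (- K) (p b) (p u)"
    if "u \<in> S" "u \<noteq> b" "edge_arc b u \<inter> K = {}" for u K
    using connected_componentI2[of "edge_arc b u" K "p b" "p u"] connected_arc_between[OF A1[of b u]]
      ends[of b u] mem that by auto
  have Z: "edge_arc b u \<inter> (edge_arc s t \<union> (edge_arc s v \<union> edge_arc v t)) = {}"
    if "u \<in> S" "s \<in> S" "t \<in> S" "v \<in> S" "distinct [b, u, s, t, v]" for u s t v
    using that mem D0[of b u s t] D0[of b u s v] D0[of b u v t] by auto
  have c1: "\<not> connected_component (- C) (p b) q"
  proof
    assume *: "connected_component (- C) (p b) q"
    show False
      by (rule chord[OF _ _ _ _ _ C_def q * star[OF _ _ Z] star[OF _ _ Z]]) (use dist mem in auto)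
  qed
  have c2: "\<not> connected_component (- C) (p b) m"
  proof
    assume *: "connected_component (- C) (p b) m"
    show False
      by (rule chord[OF _ _ _ _ _ C' m * star[OF _ _ Z] star[OF _ _ Z]]) (use dist mem in auto)
  qed
  have c3: "\<not> connected_component (- C) m q"
  proof
    assume *: "connected_component (- C) m q"
    \<comment> \<open>Here the viewpoint \<open>m\<close> lies on the diagonal az: it sees a and z
      along that diagonal itself, with the opposite end removed.\<close>
    have con: "connected (edge_arc a z - {p a})" "connected (edge_arc a z - {p z})"
      using connected_arc_between_minus_start connected_arc_between_minus_finish
        A1[of a z] mem dist by auto
    show False
    proof (rule chord[OF _ _ _ _ _ C_def q *])
      show "connected_component (- (edge_arc x y \<union> (edge_arc x z \<union> edge_arc z y))) m (p a)"
        by (rule connected_componentI2[OF con(2)])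
         (use dist mem m ends[of a z] pne[of a z] D0[of a z x y] D1[of a z x] D1[of a z y] in \<open>auto simp: edge_arc_commute\<close>)
      show "connected_component (- (edge_arc x y \<union> (edge_arc x a \<union> edge_arc a y))) m (p z)"
        by (rule connected_componentI2[OF con(1)])
         (use dist mem m ends[of a z] pne[of a z] D0[of a z x y] D1[of z a x] D1[of z a y] in \<open>auto simp: edge_arc_commute\<close>)
    qed (use dist mem in auto)
  qed
  have cycle: "(edge_arc x a \<union> edge_arc a y) \<inter> (edge_arc x z \<union> edge_arc z y) \<subseteq> {p x, p y}"
    using D0[of x a z y] D0[of a y x z] D1[of a x z] D1[of a y z] dist mem
    by (auto simp: edge_arc_commute)
  obtain U W where UW: "connected U" "connected W" "U \<union> W = - C"
    by (rule Jordan_two_arcs[OF A2[of x a y] A2[of x z y] cycle]) (use dist mem in \<open>auto simp: C_def\<close>)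
  have same: "connected_component (- C) s t" if "s \<in> U \<and> t \<in> U \<or> s \<in> W \<and> t \<in> W" for s t
    using that UW unfolding connected_component_def by blast
  have "p b \<in> U \<union> W" "q \<in> U \<union> W" "m \<in> U \<union> W" using UW q m qC mC bC by auto
  then show False using same c1 c2 c3 by blast
qed

text \<open>The arcs aw and wb concatenate to an arc for ab, and all other edges at \<open>w\<close>
  are dropped. If ab was already an edge, its old arc is overwritten, so the two cases need no
  distinction.\<close>

lemma planar_suppress_vertex:
  assumes aw: "{a, w} \<in> edges G" and wb: "{w, b} \<in> edges G" and ab: "a \<noteq> b"
  shows "planar_graph (vertices G - {w}, insert {a, b} {e \<in> edges G. w \<notin> e})"
    (is "planar_graph ?H")
proof -
  obtain h where h: "arc h" "path_image h = edge_arc a w \<union> edge_arc w b"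
    "pathstart h = p a" "pathfinish h = p b"
    using arc_between_two_edges[OF assms] by (auto simp: arc_between_def)
  have V: "a \<in> vertices G" "b \<in> vertices G" "a \<noteq> w" "b \<noteq> w"
    using edge_doubleton[OF simple aw] edge_doubleton[OF simple wb] by auto
  have "plane_drawing ?H p (\<gamma>({a, b} := h))"
  proof (rule plane_drawingI)
    show "inj_on p (vertices ?H)"
      using drawing by (auto simp: plane_drawing_def inj_on_def)
    show "e \<subseteq> vertices ?H" if "e \<in> edges ?H" for e
      using that V simple unfolding simple_graph_def nsets_def by auto
    show "arc ((\<gamma>({a, b} := h)) e) \<and>
        {pathstart ((\<gamma>({a, b} := h)) e), pathfinish ((\<gamma>({a, b} := h)) e)} = p ` e"
      if "e \<in> edges ?H" for e
      using that h drawing by (auto simp: plane_drawing_def)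
    show "v \<in> e" if "e \<in> edges ?H" "v \<in> vertices ?H" "p v \<in> path_image ((\<gamma>({a, b} := h)) e)" for e v
    proof (cases "e = {a, b}")
      case True
      then show ?thesis
        using that h vertex_on_edge[OF aw, of v] vertex_on_edge[OF wb, of v]
        by (auto simp: edge_arc_def)
    next
      case False
      then show ?thesis using that vertex_on_edge[of e v] by auto
    qed
    have new: "path_image (\<gamma> f) \<inter> path_image h \<subseteq> p ` (f \<inter> {a, b})"
      if "f \<in> edges G" "w \<notin> f" for f
      using edges_meet_at_ends[OF that(1) aw] edges_meet_at_ends[OF that(1) wb] that h
      by (auto simp: edge_arc_def)
    show "path_image ((\<gamma>({a, b} := h)) e) \<inter> path_image ((\<gamma>({a, b} := h)) f) \<subseteq> p ` (e \<inter> f)"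
      if ef: "e \<in> edges ?H" "f \<in> edges ?H" "e \<noteq> f" for e f
    proof -
      consider "e = {a, b}" "f \<noteq> {a, b}" | "f = {a, b}" "e \<noteq> {a, b}" | "e \<noteq> {a, b}" "f \<noteq> {a, b}"
        using ef(3) by blast
      then show ?thesis
      proof cases
        case 1
        then show ?thesis using ef new[of f] by (simp add: Int_commute)
      next
        case 2
        then show ?thesis using ef new[of e] by simp
      next
        case 3
        then show ?thesis using ef edges_meet_at_ends[of e f] by simp
      qed
    qed
  qed
  then show ?thesis unfolding planar_graph_def by blast
qed

end

lemma simple_graph_suppress_vertex:
  assumes "simple_graph G" "{a, w} \<in> edges G" "{w, b} \<in> edges G" "a \<noteq> b"
  shows "simple_graph (vertices G - {w}, insert {a, b} {e \<in> edges G. w \<notin> e})"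
proof -
  have "a \<in> vertices G" "b \<in> vertices G" "a \<noteq> w" "b \<noteq> w"
    using edge_doubleton[OF assms(1,2)] edge_doubleton[OF assms(1,3)] by auto
  then show ?thesis
    using assms(1,4) unfolding simple_graph_def by (auto simp: nsets_def)
qed

section \<open>Decomposition of graphs without induced paths on four vertices\<close>

definition induced_P4 :: "'a sgraph \<Rightarrow> 'a \<Rightarrow> 'a \<Rightarrow> 'a \<Rightarrow> 'a \<Rightarrow> bool" where
  "induced_P4 G a b c d \<longleftrightarrow> distinct [a, b, c, d] \<and>
     {a, b} \<in> edges G \<and> {b, c} \<in> edges G \<and> {c, d} \<in> edges G \<and>
     {a, c} \<notin> edges G \<and> {b, d} \<notin> edges G \<and> {a, d} \<notin> edges G"

lemma vertices_path_graph_4: "vertices (path_graph 4) = {0, 1, 2, 3}"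
  by (auto simp: path_graph_def)

lemma edges_path_graph_4: "edges (path_graph 4) = {{0, 1}, {1, 2}, {2, 3}}"
proof -
  have "edges (path_graph 4) = (\<lambda>i. {i, Suc i}) ` {i. Suc i < 4}"
    by (auto simp: path_graph_def)
  also have "{i. Suc i < 4} = {0, 1, 2}" by auto
  finally show ?thesis by (simp add: numeral_eq_Suc)
qed

lemma induced_free_P4_iff:
  assumes "simple_graph G"
  shows "induced_free (path_graph 4) G \<longleftrightarrow> (\<forall>a b c d. \<not> induced_P4 G a b c d)"
proof
  assume free: "induced_free (path_graph 4) G"
  show "\<forall>a b c d. \<not> induced_P4 G a b c d"
  proof (intro allI notI)
    fix a b c d assume P: "induced_P4 G a b c d"
    let ?S = "{a, b, c, d}"
    define f where "f i = (if i = 0 then a else if i = 1 then b else if i = 2 then c else d)" for i :: nat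
    have "bij_betw f (vertices (path_graph 4)) (vertices (induced_subgraph G ?S))"
      using P unfolding bij_betw_def vertices_path_graph_4
      by (auto simp: induced_P4_def f_def inj_on_def induced_subgraph_def)
    moreover have "{e \<in> edges G. e \<subseteq> ?S} = {{a, b}, {b, c}, {c, d}}"
    proof
      show "{{a, b}, {b, c}, {c, d}} \<subseteq> {e \<in> edges G. e \<subseteq> ?S}"
        using P by (auto simp: induced_P4_def)
      show "{e \<in> edges G. e \<subseteq> ?S} \<subseteq> {{a, b}, {b, c}, {c, d}}"
      proof
        have neg: "{c, a} \<notin> edges G" "{d, b} \<notin> edges G" "{d, a} \<notin> edges G"
          using P by (simp_all add: induced_P4_def insert_commute)
        fix e assume e: "e \<in> {e \<in> edges G. e \<subseteq> ?S}"
        then have "e \<in> edges G" by simp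
        then obtain u v where uv: "e = {u, v}" "u \<noteq> v"
          by (rule simple_graph_edgeE[OF assms])
        have "u = a \<or> u = b \<or> u = c \<or> u = d" "v = a \<or> v = b \<or> v = c \<or> v = d"
          using e uv by auto
        moreover have "{u, v} \<in> edges G" using e uv by simp
        moreover have "{a, c} \<notin> edges G" "{b, d} \<notin> edges G" "{a, d} \<notin> edges G"
          using P by (simp_all add: induced_P4_def)
        ultimately have "{u, v} \<in> {{a, b}, {b, c}, {c, d}}"
          using neg uv(2) by (elim disjE) (simp_all add: insert_commute)
        then show "e \<in> {{a, b}, {b, c}, {c, d}}" using uv by simp
      qed
    qed
    then have "edges (induced_subgraph G ?S) = (\<lambda>e. f ` e) ` edges (path_graph 4)"
      unfolding edges_path_graph_4 by (simp add: f_def induced_subgraph_def insert_commute)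
    ultimately have "graph_iso (path_graph 4) (induced_subgraph G ?S)"
      unfolding graph_iso_def by blast
    moreover have "?S \<subseteq> vertices G"
      using P edge_doubleton(1,2)[OF assms, of a b] edge_doubleton(1,2)[OF assms, of c d]
      unfolding induced_P4_def by simp
    ultimately show False using free unfolding induced_free_def by blast
  qed
next
  assume free: "\<forall>a b c d. \<not> induced_P4 G a b c d"
  show "induced_free (path_graph 4) G"
    unfolding induced_free_def
  proof
    assume "\<exists>S\<subseteq>vertices G. graph_iso (path_graph 4) (induced_subgraph G S)"
    then obtain S f where bij: "bij_betw f {0, 1, 2, 3 :: nat} S"
      and E: "{e \<in> edges G. e \<subseteq> S} = {{f 0, f 1}, {f 1, f 2}, {f 2, f 3}}"
      unfolding graph_iso_def edges_path_graph_4 vertices_path_graph_4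
      by (auto simp: induced_subgraph_def)
    have d: "distinct [f 0, f 1, f 2, f 3]"
      using bij by (auto simp: bij_betw_def inj_on_def)
    have S: "{f 0, f 1, f 2, f 3} \<subseteq> S" using bij by (auto simp: bij_betw_def)
    have iff: "{u, v} \<in> edges G \<longleftrightarrow> {u, v} \<in> {{f 0, f 1}, {f 1, f 2}, {f 2, f 3}}"
      if "u \<in> S" "v \<in> S" for u v
      unfolding E[symmetric] using that by simp
    have "induced_P4 G (f 0) (f 1) (f 2) (f 3)"
      unfolding induced_P4_def using d S iff by (auto simp: doubleton_eq_iff)
    then show False using free by blast
  qed
qed

text \<open>Disjoint union and join are the two halves of one disjunction over an arbitrary
  relation, which makes the notion invariant under complementation.\<close>

definition splits :: "('a \<Rightarrow> 'a \<Rightarrow> bool) \<Rightarrow> 'a set \<Rightarrow> bool" where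
  "splits R S \<longleftrightarrow> (\<exists>A B. A \<union> B = S \<and> A \<inter> B = {} \<and> A \<noteq> {} \<and> B \<noteq> {} \<and>
     ((\<forall>a\<in>A. \<forall>b\<in>B. R a b) \<or> (\<forall>a\<in>A. \<forall>b\<in>B. \<not> R a b)))"

definition P4_free_on :: "('a \<Rightarrow> 'a \<Rightarrow> bool) \<Rightarrow> 'a set \<Rightarrow> bool" where
  "P4_free_on R S \<longleftrightarrow> (\<forall>a\<in>S. \<forall>b\<in>S. \<forall>c\<in>S. \<forall>d\<in>S. distinct [a, b, c, d] \<longrightarrow>
     R a b \<longrightarrow> R b c \<longrightarrow> R c d \<longrightarrow> R a c \<or> R b d \<or> R a d)"

lemma splits_complement: "splits (\<lambda>x y. \<not> R x y) S \<longleftrightarrow> splits R S"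
  unfolding splits_def by auto

text \<open>The path on four vertices is self-complementary: the complement of a b c d is the path c
  a d b.\<close>

lemma P4_free_on_complement:
  assumes "P4_free_on R S" "symp R"
  shows "P4_free_on (\<lambda>x y. \<not> R x y) S"
  unfolding P4_free_on_def
proof (intro ballI impI)
  fix a b c d assume "a \<in> S" "b \<in> S" "c \<in> S" "d \<in> S" "distinct [a, b, c, d]"
    and non: "\<not> R a b" "\<not> R b c" "\<not> R c d"
  then have "R c a \<Longrightarrow> R a d \<Longrightarrow> R d b \<Longrightarrow> R c d \<or> R a b \<or> R c b"
    using assms(1)[unfolded P4_free_on_def, rule_format, of c a d b] by auto
  then show "\<not> R a c \<or> \<not> R b d \<or> \<not> R a d"
    using non \<open>symp R\<close> by (meson sympD)
qed

text \<open>If nothing splits, \<open>v\<close> has a nonneighbour in \<open>T\<close>, and some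
  nonneighbour y is adjacent to a vertex x outside \<open>M\<close>, which must be a neighbour of
  \<open>v\<close>. Being adjacent, x and y lie on the same side of \<open>T\<close>; the other side
  contains a neighbour z of \<open>v\<close>, as otherwise it would split off. Then z v x y is an
  induced path.\<close>

lemma splits_insert:
  assumes free: "P4_free_on R (insert v T)" and sym: "symp R" and v: "v \<notin> T"
    and T: "A \<union> B = T" "A \<inter> B = {}" "A \<noteq> {}" "B \<noteq> {}" "\<forall>a\<in>A. \<forall>b\<in>B. \<not> R a b"
  shows "splits R (insert v T)"
proof (rule ccontr)
  assume no: "\<not> splits R (insert v T)"
  have nosplit: "(\<exists>x\<in>X. \<exists>y\<in>insert v T - X. R x y) \<and> (\<exists>x\<in>X. \<exists>y\<in>insert v T - X. \<not> R x y)"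
    if "X \<noteq> {}" "X \<subseteq> T" for X
  proof -
    have "X \<union> (insert v T - X) = insert v T" "X \<inter> (insert v T - X) = {}" "insert v T - X \<noteq> {}"
      using that v by auto
    then show ?thesis using no that unfolding splits_def by blast
  qed
  define M where "M = {x \<in> T. \<not> R x v}"
  have symR: "R x y \<Longrightarrow> R y x" for x y using sym by (rule sympD)
  have "M \<noteq> {}" using nosplit[of T] T v unfolding M_def by auto
  then obtain y x where y: "y \<in> M" and x: "x \<in> insert v T - M" and yx: "R y x"
    using nosplit[of M] unfolding M_def by blast
  have yx': "y \<in> T" "\<not> R y v" "x \<in> T" "R x v"
    using y x yx unfolding M_def by auto
  have "\<exists>z\<in>T. R z v \<and> \<not> R z x \<and> \<not> R z y"
  proof (cases "x \<in> A")
    case True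
    then have "y \<in> A" using yx yx' T symR by blast
    obtain z where "z \<in> B" "R z v"
      using nosplit[of B] T symR by blast
    then show ?thesis using True \<open>y \<in> A\<close> T symR by blast
  next
    case False
    then have "x \<in> B" "y \<in> B" using yx yx' T symR by blast+
    obtain z where "z \<in> A" "R z v"
      using nosplit[of A] T symR by blast
    then show ?thesis using \<open>x \<in> B\<close> \<open>y \<in> B\<close> T by blast
  qed
  then obtain z where z: "z \<in> T" "R z v" "\<not> R z x" "\<not> R z y" by blast
  have "distinct [z, v, x, y]" using z yx yx' v symR by auto
  then show False
    using free z yx yx' symR unfolding P4_free_on_def by blast
qed

text \<open>Seinsche's theorem on cographs, by removing one vertex. If the rest is a join, it is a
  disjoint union for the complement relation, so \<open>splits_insert\<close> covers both
  cases.\<close>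

lemma P4_free_splits:
  assumes "finite S" "card S \<ge> 2" "symp R" "P4_free_on R S"
  shows "splits R S"
  using assms(1,2,4)
proof (induction S rule: finite_induct)
  case empty
  then show ?case by simp
next
  case (insert v T)
  show ?case
  proof (cases "card T \<ge> 2")
    case True
    have "P4_free_on R T" using insert.prems unfolding P4_free_on_def by blast
    then have "splits R T" using insert.IH True by blast
    then obtain A B where T: "A \<union> B = T" "A \<inter> B = {}" "A \<noteq> {}" "B \<noteq> {}"
      and "(\<forall>a\<in>A. \<forall>b\<in>B. R a b) \<or> (\<forall>a\<in>A. \<forall>b\<in>B. \<not> R a b)"
      unfolding splits_def by blast
    then show ?thesis
    proof (elim disjE)
      assume "\<forall>a\<in>A. \<forall>b\<in>B. \<not> R a b"
      then show ?thesis
        using splits_insert[OF insert.prems(2) \<open>symp R\<close> insert.hyps(2) T] by blast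
    next
      assume "\<forall>a\<in>A. \<forall>b\<in>B. R a b"
      moreover have "symp (\<lambda>x y. \<not> R x y)" using \<open>symp R\<close> by (auto simp: symp_def)
      ultimately have "splits (\<lambda>x y. \<not> R x y) (insert v T)"
        using splits_insert[OF P4_free_on_complement[OF insert.prems(2) \<open>symp R\<close>] _ insert.hyps(2) T]
        by blast
      then show ?thesis by (simp add: splits_complement)
    qed
  next
    case False
    then have "card T = 1" using insert by simp
    then obtain u where "T = {u}" by (auto simp: card_1_singleton_iff)
    then have "{v} \<union> {u} = insert v T" "{v} \<inter> {u} = {}" using insert.hyps by auto
    then show ?thesis unfolding splits_def by blast
  qed
qed

section \<open>The upper bound\<close>

locale P4_free_drawing = drawing +
  assumes P4_free: "\<not> induced_P4 G a b c d"
begin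

text \<open>Counting inside vertex sets of one fixed drawing lets the inductions run over sets, with
  no restriction of drawings to subgraphs.\<close>

definition edges_in :: "'a set \<Rightarrow> nat" where
  "edges_in S = card {f \<in> edges G. f \<subseteq> S}"

lemma finite_vertices: "finite (vertices G)"
  using simple by (simp add: simple_graph_def)

lemma finite_edges: "finite (edges G)"
  using simple finite_imp_finite_nsets finite_subset unfolding simple_graph_def by blast

lemma edges_in_le_choose: "finite S \<Longrightarrow> edges_in S \<le> card S choose 2"
proof -
  assume "finite S"
  have "{f \<in> edges G. f \<subseteq> S} \<subseteq> [S]\<^bsup>2\<^esup>"
    using simple by (auto simp: simple_graph_def nsets_def)
  then have "edges_in S \<le> card ([S]\<^bsup>2\<^esup>)"
    unfolding edges_in_def using \<open>finite S\<close> by (intro card_mono finite_imp_finite_nsets)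
  then show ?thesis by simp
qed

lemma edges_in_eq_0: "finite S \<Longrightarrow> card S < 2 \<Longrightarrow> edges_in S = 0"
  using edges_in_le_choose[of S] by (simp add: binomial_eq_0)

text \<open>The sets may overlap, so that one inequality serves both disjoint unions and gluing at a
  common vertex.\<close>

lemma edges_in_Un_le:
  assumes "\<And>x y. x \<in> X - Y \<Longrightarrow> y \<in> Y - X \<Longrightarrow> {x, y} \<notin> edges G"
  shows "edges_in (X \<union> Y) \<le> edges_in X + edges_in Y"
proof -
  have "{f \<in> edges G. f \<subseteq> X \<union> Y} \<subseteq> {f \<in> edges G. f \<subseteq> X} \<union> {f \<in> edges G. f \<subseteq> Y}"
  proof
    fix f assume f: "f \<in> {f \<in> edges G. f \<subseteq> X \<union> Y}"
    then have "f \<in> edges G" by simp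
    then obtain u v where uv: "f = {u, v}" by (rule simple_graph_edgeE[OF simple])
    then have "\<not> (u \<in> X - Y \<and> v \<in> Y - X)" "\<not> (v \<in> X - Y \<and> u \<in> Y - X)"
      using assms[of u v] assms[of v u] f by (auto simp: insert_commute)
    then show "f \<in> {f \<in> edges G. f \<subseteq> X} \<union> {f \<in> edges G. f \<subseteq> Y}"
      using f uv by auto
  qed
  then have "edges_in (X \<union> Y) \<le> card ({f \<in> edges G. f \<subseteq> X} \<union> {f \<in> edges G. f \<subseteq> Y})"
    unfolding edges_in_def by (rule card_mono[rotated]) (simp add: finite_edges)
  also have "\<dots> \<le> edges_in X + edges_in Y" unfolding edges_in_def by (rule card_Un_le)
  finally show ?thesis .
qed

lemma edges_in_Un_le_prod:
  assumes "finite A" "finite B"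
  shows "edges_in (A \<union> B) \<le> edges_in A + edges_in B + card A * card B"
proof -
  let ?J = "(\<lambda>(x, y). {x, y}) ` (A \<times> B)"
  have "{f \<in> edges G. f \<subseteq> A \<union> B} \<subseteq> {f \<in> edges G. f \<subseteq> A} \<union> {f \<in> edges G. f \<subseteq> B} \<union> ?J"
  proof
    fix f assume f: "f \<in> {f \<in> edges G. f \<subseteq> A \<union> B}"
    then have "f \<in> edges G" by simp
    then obtain u v where uv: "f = {u, v}" by (rule simple_graph_edgeE[OF simple])
    have "f \<in> ?J" if "u \<in> A \<and> v \<in> B \<or> v \<in> A \<and> u \<in> B"
      using that uv by (auto simp: image_iff doubleton_eq_iff)
    then show "f \<in> {f \<in> edges G. f \<subseteq> A} \<union> {f \<in> edges G. f \<subseteq> B} \<union> ?J"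
      using f uv by blast
  qed
  then have "edges_in (A \<union> B) \<le> card ({f \<in> edges G. f \<subseteq> A} \<union> {f \<in> edges G. f \<subseteq> B} \<union> ?J)"
    unfolding edges_in_def using assms by (intro card_mono) (auto simp: finite_edges)
  also have "\<dots> \<le> card ({f \<in> edges G. f \<subseteq> A} \<union> {f \<in> edges G. f \<subseteq> B}) + card ?J"
    by (rule card_Un_le)
  also have "\<dots> \<le> edges_in A + edges_in B + card (A \<times> B)"
    unfolding edges_in_def using assms by (intro add_mono card_Un_le card_image_le) auto
  finally show ?thesis by (simp add: card_cartesian_product)
qed

lemma split_cases:
  assumes "finite S" "card S \<ge> 2"
  obtains (union) A B where "S = A \<union> B" "A \<inter> B = {}" "A \<noteq> {}" "B \<noteq> {}"
      "\<And>a b. a \<in> A \<Longrightarrow> b \<in> B \<Longrightarrow> {a, b} \<notin> edges G"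
  | (join) A B where "S = A \<union> B" "A \<inter> B = {}" "A \<noteq> {}" "card A \<le> card B"
      "\<And>a b. a \<in> A \<Longrightarrow> b \<in> B \<Longrightarrow> {a, b} \<in> edges G"
proof -
  have "P4_free_on (\<lambda>x y. {x, y} \<in> edges G) S"
    using P4_free unfolding P4_free_on_def induced_P4_def by blast
  moreover have "symp (\<lambda>x y. {x, y} \<in> edges G)"
    by (simp add: symp_def insert_commute)
  ultimately have "splits (\<lambda>x y. {x, y} \<in> edges G) S"
    using P4_free_splits assms by blast
  then obtain A B where AB: "A \<union> B = S" "A \<inter> B = {}" "A \<noteq> {}" "B \<noteq> {}"
    and "(\<forall>a\<in>A. \<forall>b\<in>B. {a, b} \<in> edges G) \<or> (\<forall>a\<in>A. \<forall>b\<in>B. {a, b} \<notin> edges G)"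
    unfolding splits_def by blast
  then show thesis
  proof (elim disjE)
    assume "\<forall>a\<in>A. \<forall>b\<in>B. {a, b} \<notin> edges G"
    then show thesis using union[of A B] AB by blast
  next
    assume "\<forall>a\<in>A. \<forall>b\<in>B. {a, b} \<in> edges G"
    then have *: "{a, b} \<in> edges G" "{b, a} \<in> edges G" if "a \<in> A" "b \<in> B" for a b
      using that by (auto simp: insert_commute[of b a])
    show thesis
    proof (cases "card A \<le> card B")
      case True
      show thesis by (rule join[of A B]) (use True AB * in auto)
    next
      case False
      show thesis by (rule join[of B A]) (use False AB * in auto)
    qed
  qed
qed

section \<open>Obstructions to dense joins\<close>

lemma no_K33_ge:
  assumes "card A \<ge> 3" "card B \<ge> 3"
    and E: "\<And>a b. a \<in> A \<Longrightarrow> b \<in> B \<Longrightarrow> {a, b} \<in> edges G"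
  shows False
proof -
  obtain A' where A': "A' \<subseteq> A" "card A' = 3" using obtain_subset_with_card_n[OF assms(1)] by metis
  obtain B' where B': "B' \<subseteq> B" "card B' = 3" using obtain_subset_with_card_n[OF assms(2)] by metis
  show False by (rule no_K33[OF A'(2) B'(2)]) (use E A' B' in auto)
qed

text \<open>Suppressing \<open>w\<close> turns the path a w b into the edge ab, the only one that
  may be missing inside \<open>S\<close>.\<close>

lemma no_K5_subdivided:
  assumes "card S = 5" "a \<in> S" "b \<in> S" "a \<noteq> b" "w \<notin> S" "{a, w} \<in> edges G" "{w, b} \<in> edges G"
    and E: "\<And>u v. u \<in> S \<Longrightarrow> v \<in> S \<Longrightarrow> u \<noteq> v \<Longrightarrow> {u, v} \<noteq> {a, b} \<Longrightarrow> {u, v} \<in> edges G"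
  shows False
proof -
  let ?H = "(vertices G - {w}, insert {a, b} {e \<in> edges G. w \<notin> e})"
  obtain p' \<gamma>' where "plane_drawing ?H p' \<gamma>'"
    using planar_suppress_vertex[OF assms(6,7,4)] unfolding planar_graph_def by blast
  then interpret H: drawing ?H p' \<gamma>'
    using simple_graph_suppress_vertex[OF simple assms(6,7,4)] by unfold_locales
  show False
  proof (rule H.no_K5[OF \<open>card S = 5\<close>])
    show "{u, v} \<in> edges ?H" if "u \<in> S" "v \<in> S" "u \<noteq> v" for u v
      using E[OF that] that \<open>w \<notin> S\<close> by auto
  qed
qed

lemma no_K33_subdivided:
  assumes "card A = 3" "card B = 3" "a \<in> A" "b \<in> B" "a \<noteq> b" "w \<notin> A" "w \<notin> B"
    "{a, w} \<in> edges G" "{w, b} \<in> edges G"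
    and E: "\<And>u v. u \<in> A \<Longrightarrow> v \<in> B \<Longrightarrow> {u, v} \<noteq> {a, b} \<Longrightarrow> {u, v} \<in> edges G"
  shows False
proof -
  let ?H = "(vertices G - {w}, insert {a, b} {e \<in> edges G. w \<notin> e})"
  obtain p' \<gamma>' where "plane_drawing ?H p' \<gamma>'"
    using planar_suppress_vertex[OF assms(8,9,5)] unfolding planar_graph_def by blast
  then interpret H: drawing ?H p' \<gamma>'
    using simple_graph_suppress_vertex[OF simple assms(8,9,5)] by unfold_locales
  show False
  proof (rule H.no_K33[OF assms(1,2)])
    show "{u, v} \<in> edges ?H" if "u \<in> A" "v \<in> B" for u v
      using E[OF that] that \<open>w \<notin> A\<close> \<open>w \<notin> B\<close> by auto
  qed
qed

text \<open>Each component is a path on at most three vertices, and \<open>P\<^sub>3\<close> attains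
  the ratio of two edges to three vertices. The exclusions are of subgraphs, not only of induced
  ones.\<close>

lemma edges_in_sparse:
  assumes "finite B"
    and tri: "\<And>x y z. x \<in> B \<Longrightarrow> y \<in> B \<Longrightarrow> z \<in> B \<Longrightarrow> {x, y} \<in> edges G \<Longrightarrow> {y, z} \<in> edges G \<Longrightarrow> {x, z} \<notin> edges G"
    and claw: "\<And>c X. c \<in> B \<Longrightarrow> X \<subseteq> B \<Longrightarrow> (\<And>x. x \<in> X \<Longrightarrow> {c, x} \<in> edges G) \<Longrightarrow> card X < 3"
    and C4: "\<And>X Y. X \<subseteq> B \<Longrightarrow> Y \<subseteq> B \<Longrightarrow> (\<And>x y. x \<in> X \<Longrightarrow> y \<in> Y \<Longrightarrow> {x, y} \<in> edges G) \<Longrightarrow>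
       card X < 2 \<or> card Y < 2"
  shows "3 * edges_in B \<le> 2 * card B"
proof -
  have "3 * edges_in S \<le> 2 * card S" if "S \<subseteq> B" for S
    using finite_subset[OF that \<open>finite B\<close>] that
  proof (induction S rule: finite_psubset_induct)
    case (psubset S)
    show ?case
    proof (cases "card S \<ge> 2")
      case False
      then have "edges_in S = 0" using edges_in_eq_0[OF psubset.hyps] by simp
      then show ?thesis by simp
    next
      case True
      from psubset.hyps True show ?thesis
      proof (cases rule: split_cases)
        case (union A C)
        then have "A \<subset> S" "C \<subset> S" by auto
        then have "3 * edges_in A \<le> 2 * card A" "3 * edges_in C \<le> 2 * card C"
          using psubset by blast+
        moreover have "edges_in S \<le> edges_in A + edges_in C" using union by (auto intro!: edges_in_Un_le)
        moreover have "card S = card A + card C"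
          using union psubset.hyps by (simp add: card_Un_disjoint)
        ultimately show ?thesis by simp
      next
        case (join A C)
        have sub: "A \<subseteq> B" "C \<subseteq> B" using join psubset.prems by auto
        have fin: "finite A" "finite C" using join psubset.hyps by auto
        then have "card A > 0" using join by (simp add: card_gt_0_iff)
        then have "card C > 0" using join by simp
        then obtain a c where ac: "a \<in> A" "c \<in> C" using join by fastforce
        have "card C < 3" using claw[of a C] ac join(5) sub by blast
        moreover have "card A < 2 \<or> card C < 2" using C4[OF sub] join(5) by blast
        \<comment> \<open>A join inside \<open>B\<close> can only be a star with one or two leaves:
          the claw condition bounds \<open>C\<close>, the 4-cycle condition bounds \<open>A\<close>.
          Triangle-freeness then empties \<open>C\<close> of edges.\<close>
        ultimately have "card A = 1 \<and> (card C = 1 \<or> card C = 2)"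
          using \<open>card A > 0\<close> \<open>card C > 0\<close> join(4) by linarith
        moreover have "edges_in A = 0"
          using edges_in_eq_0[OF fin(1)] calculation by simp
        moreover have "{f \<in> edges G. f \<subseteq> C} = {}"
        proof -
          have False if f: "f \<in> edges G" "f \<subseteq> C" for f
          proof -
            obtain u v where "f = {u, v}" using f(1) by (rule simple_graph_edgeE[OF simple])
            then show False using tri[of a u v] f ac join(5) sub by blast
          qed
          then show ?thesis by blast
        qed
        then have "edges_in C = 0" unfolding edges_in_def by (simp only: card.empty)
        moreover have "edges_in S \<le> edges_in A + edges_in C + card A * card C"
          using edges_in_Un_le_prod[OF fin] join by simp
        moreover have "card S = card A + card C"
          using join fin by (simp add: card_Un_disjoint)
        ultimately show ?thesis by auto
      qed
    qed
  qed
  then show ?thesis by blast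
qed

text \<open>With k = \<open>card B\<close> there is at most one edge in the pair, at most 2k across
  and at most 2k/3 inside \<open>B\<close>; the work lies in verifying the hypotheses of
  \<open>edges_in_sparse\<close>.\<close>

lemma edges_in_join_two:
  assumes "finite B" "card B \<ge> 5" "a \<noteq> b" "a \<notin> B" "b \<notin> B"
    and aB: "\<And>x. x \<in> B \<Longrightarrow> {a, x} \<in> edges G" and bB: "\<And>x. x \<in> B \<Longrightarrow> {b, x} \<in> edges G"
  shows "3 * edges_in ({a, b} \<union> B) \<le> 8 * card B + 3"
proof -
  have Ba: "{x, a} \<in> edges G" and Bb: "{x, b} \<in> edges G" if "x \<in> B" for x
    using aB[OF that] bB[OF that] by (simp_all add: insert_commute)
  have ne: "x \<noteq> a" "x \<noteq> b" if "x \<in> B" for x using that assms by auto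
  \<comment> \<open>A triangle or 4-cycle uses at most four vertices of \<open>B\<close>, so a fifth
    remains to link a and b.\<close>
  have spare: "\<exists>w\<in>B. w \<notin> T" if "finite T" "card T < 5" for T
  proof (rule ccontr)
    assume "\<not> ?thesis"
    then have "card B \<le> card T" using that by (intro card_mono) auto
    then show False using that assms by simp
  qed
  have "3 * edges_in B \<le> 2 * card B"
  proof (rule edges_in_sparse[OF \<open>finite B\<close>])
    show "{x, z} \<notin> edges G" if xyz: "x \<in> B" "y \<in> B" "z \<in> B" "{x, y} \<in> edges G" "{y, z} \<in> edges G" for x y z
    proof
      assume xz: "{x, z} \<in> edges G"
      have d: "x \<noteq> y" "y \<noteq> z" "x \<noteq> z"
        using edge_doubleton(3)[OF simple] xyz xz by blast+
      obtain w where w: "w \<in> B" "w \<notin> {x, y, z}"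
        using spare[of "{x, y, z}"] d by auto
      show False
      \<comment> \<open>A triangle together with a and b is a \<open>K\<^sub>5\<close> up to the
        edge ab, which the path through w replaces.\<close>
      proof (rule no_K5_subdivided[of "{a, b, x, y, z}" a b w])
        show "{u, v} \<in> edges G" if "u \<in> {a, b, x, y, z}" "v \<in> {a, b, x, y, z}" "u \<noteq> v" "{u, v} \<noteq> {a, b}" for u v
        proof -
          have "{y, x} \<in> edges G" "{z, x} \<in> edges G" "{z, y} \<in> edges G"
            using xyz xz by (simp_all add: insert_commute)
          moreover have "\<not> (u = a \<and> v = b)" "\<not> (u = b \<and> v = a)"
            using that by (auto simp: insert_commute)
          moreover have "u = a \<or> u = b \<or> u = x \<or> u = y \<or> u = z" "v = a \<or> v = b \<or> v = x \<or> v = y \<or> v = z"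
            using that by simp_all
          ultimately show ?thesis
            using xyz xz aB[OF xyz(1)] aB[OF xyz(2)] aB[OF xyz(3)] bB[OF xyz(1)] bB[OF xyz(2)] bB[OF xyz(3)]
              Ba[OF xyz(1)] Ba[OF xyz(2)] Ba[OF xyz(3)] Bb[OF xyz(1)] Bb[OF xyz(2)] Bb[OF xyz(3)] that(3)
            by metis
        qed
      qed (use d ne[OF xyz(1)] ne[OF xyz(2)] ne[OF xyz(3)] \<open>a \<noteq> b\<close> w ne[OF w(1)] aB[OF w(1)] Bb[OF w(1)] in auto)
    qed
    show "card X < 3" if "c \<in> B" "X \<subseteq> B" "\<And>x. x \<in> X \<Longrightarrow> {c, x} \<in> edges G" for c X
    proof (rule ccontr)
      assume "\<not> card X < 3"
      \<comment> \<open>The centre c joins a and b as the third common neighbour of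
        \<open>X\<close>; no edge ab is required here.\<close>
      moreover have "card {a, b, c} = 3" using \<open>a \<noteq> b\<close> ne[OF that(1)] by auto
      ultimately show False
        using no_K33_ge[of "{a, b, c}" X] that aB bB by auto
    qed
    show "card X < 2 \<or> card Y < 2"
      if XY: "X \<subseteq> B" "Y \<subseteq> B" "\<And>x y. x \<in> X \<Longrightarrow> y \<in> Y \<Longrightarrow> {x, y} \<in> edges G" for X Y
    proof (rule ccontr)
      assume "\<not> (card X < 2 \<or> card Y < 2)"
      then have "2 \<le> card X" "2 \<le> card Y" by auto
      obtain X' where X': "X' \<subseteq> X" "card X' = 2" "finite X'"
        using obtain_subset_with_card_n[OF \<open>2 \<le> card X\<close>] by blast
      obtain Y' where Y': "Y' \<subseteq> Y" "card Y' = 2" "finite Y'"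
        using obtain_subset_with_card_n[OF \<open>2 \<le> card Y\<close>] by blast
      have "card (X' \<union> Y') < 5" using card_Un_le[of X' Y'] X' Y' by simp
      then obtain w where w: "w \<in> B" "w \<notin> X' \<union> Y'"
        using spare[of "X' \<union> Y'"] X' Y' by auto
      have notin: "a \<notin> X'" "b \<notin> Y'" using X' Y' XY assms by auto
      show False
      \<comment> \<open>The two colour classes of the 4-cycle are enlarged by a and b respectively;
        only the cross edge ab is in doubt.\<close>
      proof (rule no_K33_subdivided[of "insert a X'" "insert b Y'" a b w])
        show "{u, v} \<in> edges G" if "u \<in> insert a X'" "v \<in> insert b Y'" "{u, v} \<noteq> {a, b}" for u v
          using that XY X' Y' aB Bb by blast
      qed (use X' Y' notin w ne[OF w(1)] aB[OF w(1)] Bb[OF w(1)] \<open>a \<noteq> b\<close> in auto)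
    qed
  qed
  moreover have "edges_in {a, b} \<le> 1" using edges_in_le_choose[of "{a, b}"] \<open>a \<noteq> b\<close> by (simp add: choose_two)
  moreover have "edges_in ({a, b} \<union> B) \<le> edges_in {a, b} + edges_in B + 2 * card B"
    using edges_in_Un_le_prod[of "{a, b}" B] \<open>a \<noteq> b\<close> \<open>finite B\<close> by simp
  ultimately show ?thesis by simp
qed

text \<open>A counterexample on three or four vertices would have too many pairs, and on five
  vertices it would be \<open>K\<^sub>5\<close>. On six vertices at most two pairs are missing: if
  one vertex meets all of them, deleting it leaves \<open>K\<^sub>5\<close>; otherwise they are two
  disjoint pairs and a \<open>K\<^sub>3\<^sub>,\<^sub>3\<close> can be found.\<close>

lemma edges_in_le_small:
  assumes "finite S" "card S \<in> {3..6}"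
  shows "edges_in S + 6 \<le> 3 * card S"
proof (rule ccontr)
  assume big: "\<not> ?thesis"
  define M where "M = [S]\<^bsup>2\<^esup> - edges G"
  have "{f \<in> edges G. f \<subseteq> S} = [S]\<^bsup>2\<^esup> - M"
    using simple unfolding M_def simple_graph_def by (auto simp: nsets_def)
  then have "edges_in S = (card S choose 2) - card M"
    unfolding edges_in_def using \<open>finite S\<close> by (simp add: M_def card_Diff_subset finite_imp_finite_nsets)
  then have M: "edges_in S + card M = card S choose 2"
    using card_mono[of "[S]\<^bsup>2\<^esup>" M] \<open>finite S\<close> by (simp add: M_def finite_imp_finite_nsets)
  have K5: False if "T \<subseteq> S" "card T = 5" "\<And>u v. u \<in> T \<Longrightarrow> v \<in> T \<Longrightarrow> {u, v} \<notin> M" for T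
  proof (rule no_K5[OF that(2)])
    show "{u, v} \<in> edges G" if "u \<in> T" "v \<in> T" "u \<noteq> v" for u v
      using \<open>T \<subseteq> S\<close> that(3) that(1,2)[THEN subsetD[OF \<open>T \<subseteq> S\<close>]]
        \<open>\<And>u v. u \<in> T \<Longrightarrow> v \<in> T \<Longrightarrow> {u, v} \<notin> M\<close>[OF that(1,2)] by (simp add: M_def)
  qed
  have finM: "finite M" using \<open>finite S\<close> by (simp add: M_def finite_imp_finite_nsets)
  consider "card S = 3" | "card S = 4" | "card S = 5" | "card S = 6" using assms by force
  then show False
  proof cases
    case 1 then show ?thesis using big M by (simp add: choose_two)
  next
    case 2 then show ?thesis using big M by (simp add: choose_two)
  next
    case 3
    then have "card M = 0" using big M by (simp add: choose_two)
    then show ?thesis using K5[of S] 3 finM by simp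
  next
    case 4
    then have "card M \<le> 2" using big M by (simp add: choose_two)
    have M2: "m \<subseteq> S \<and> card m = 2" if "m \<in> M" for m using that by (auto simp: M_def nsets_def)
    show ?thesis
    proof (cases "\<exists>v\<in>S. \<forall>m\<in>M. v \<in> m")
      case True
      then obtain v where v: "v \<in> S" "\<forall>m\<in>M. v \<in> m" by blast
      have "card (S - {v}) = 5" using v 4 by simp
      then show False by (rule K5[rotated]) (use v in auto)
    next
      case False
      have "S \<noteq> {}" using 4 by auto
      have "card M = 2"
      proof (rule ccontr)
        assume "card M \<noteq> 2"
        then have "card M = 0 \<or> card M = 1" using \<open>card M \<le> 2\<close> by linarith
        then have "M = {} \<or> (\<exists>m. M = {m})" using finM by (auto simp: card_1_singleton_iff)
        moreover have "m \<noteq> {}" if "m \<in> M" for m using M2[OF that] by auto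
        ultimately show False using False M2 \<open>S \<noteq> {}\<close> by blast
      qed
      then obtain m k where mk: "M = {m, k}" by (auto simp: card_2_iff)
      then have disj: "m \<inter> k = {}" using False M2 by blast
      have m: "m \<subseteq> S" "card m = 2" "k \<subseteq> S" "card k = 2" using M2 mk by auto
      have fin: "finite m" "finite k" using m by (auto intro: card_ge_0_finite)
      have "card (S - (m \<union> k)) = 2"
        using m disj fin 4 by (simp add: card_Diff_subset card_Un_disjoint)
      then obtain t u where tu: "S - (m \<union> k) = {t, u}" "t \<noteq> u" by (auto simp: card_2_iff)
      show False
      \<comment> \<open>Each missing pair is placed inside one side, so all nine cross edges are
        present.\<close>
      proof (rule no_K33[of "insert t m" "insert u k"])
        have "t \<in> S - (m \<union> k)" "u \<in> S - (m \<union> k)" unfolding tu(1) by simp_all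
        then show "card (insert t m) = 3" "card (insert u k) = 3" using m fin by auto
        show "{a, b} \<in> edges G" if ab: "a \<in> insert t m" "b \<in> insert u k" for a b
        proof -
          have "a \<noteq> b" "{a, b} \<subseteq> S" using tu ab disj m by auto
          moreover have "{a, b} \<notin> M" using mk tu ab disj m by auto
          ultimately show ?thesis unfolding M_def by (metis DiffI doubleton_in_nsets_2 insert_subset)
        qed
      qed
    qed
  qed
qed

text \<open>The second bound is the sharp one, as 8(n - 2)/3 + 1 = (8n - 13)/3. The first is what
  the induction applies to the pieces, which may be small; the octahedron attains it (36 + 12 = 48),
  so 13 would fail at six vertices.\<close>

lemma edges_in_le:
  assumes "finite S" "card S \<ge> 2"
  shows "3 * edges_in S + 12 \<le> 8 * card S" "card S \<ge> 7 \<Longrightarrow> 3 * edges_in S + 13 \<le> 8 * card S"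
proof -
  have "3 * edges_in S + 12 \<le> 8 * card S \<and> (card S \<ge> 7 \<longrightarrow> 3 * edges_in S + 13 \<le> 8 * card S)"
    using assms
  proof (induction S rule: finite_psubset_induct)
    case (psubset S)
    have IH: "3 * edges_in T + 12 \<le> 8 * card T" if "T \<subset> S" "card T \<ge> 2" for T
      using psubset.IH that by blast
    consider "card S = 2" | "card S \<in> {3..6}" | "card S \<ge> 7" using psubset.prems by force
    then show ?case
    proof cases
      case 1
      then show ?thesis using edges_in_le_choose[OF psubset.hyps] by simp
    next
      case 2
      then show ?thesis using edges_in_le_small[OF psubset.hyps] by auto
    next
      case 3
      have two: "3 * edges_in S + 13 \<le> 8 * card S"
        if "S = A \<union> B" "A \<inter> B = {}" "card A = 2" "\<And>a b. a \<in> A \<Longrightarrow> b \<in> B \<Longrightarrow> {a, b} \<in> edges G" for A B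
      proof -
        obtain a b where "A = {a, b}" "a \<noteq> b" using \<open>card A = 2\<close> by (auto simp: card_2_iff)
        moreover have "finite A" "finite B" using that psubset.hyps by auto
        moreover from this have "card S = 2 + card B" using that by (simp add: card_Un_disjoint)
        ultimately show ?thesis using edges_in_join_two[of B a b] that 3 by auto
      qed
      have "3 * edges_in S + 13 \<le> 8 * card S"
        using psubset.hyps psubset.prems
      proof (cases rule: split_cases)
        case (union A B)
        then have fin: "finite A" "finite B" using psubset.hyps by auto
        have S: "card S = card A + card B" using union fin by (simp add: card_Un_disjoint)
        have "edges_in S \<le> edges_in A + edges_in B" using union by (auto intro!: edges_in_Un_le)
        \<comment> \<open>A single vertex violates the linear bound (12 > 8) and is kept as an
          alternative; with at least seven vertices in \<open>S\<close> the two sides cannot both be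
          single.\<close>
        have *: "3 * edges_in T + 12 \<le> 8 * card T \<or> card T = 1 \<and> edges_in T = 0"
          if "T \<subset> S" "T \<noteq> {}" "finite T" for T
        proof (cases "card T \<ge> 2")
          case False
          then have "card T = 1" using that by (simp add: card_gt_0_iff Suc_leI le_antisym not_le numeral_2_eq_2)
          then show ?thesis using edges_in_eq_0[OF that(3)] by simp
        qed (use IH that in auto)
        have "A \<subset> S" "B \<subset> S" using union by auto
        then show ?thesis
          using *[of A] *[of B] union fin S \<open>edges_in S \<le> edges_in A + edges_in B\<close> 3 by auto
      next
        case (join A B)
        then have fin: "finite A" "finite B" using psubset.hyps by auto
        have S: "card S = card A + card B" using join fin by (simp add: card_Un_disjoint)
        have "card A > 0" using join fin by (simp add: card_gt_0_iff)
        moreover have "card A < 3" using no_K33_ge[of A B] join by force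
        ultimately consider "card A = 2" | "card A = 1" by linarith
        then show ?thesis
        proof cases
          case 1
          then show ?thesis using two join by blast
        next
          case A: 2
          then obtain v where v: "A = {v}" by (auto simp: card_1_singleton_iff)
          have "card B \<ge> 2" using S A 3 by simp
          from fin(2) this show ?thesis
          proof (cases rule: split_cases)
            case (union C D)
            have CD: "finite C" "finite D" "v \<notin> C" "v \<notin> D" using union fin join v by auto
            have "card C > 0" "card D > 0" using CD union by (simp_all add: card_gt_0_iff)
            moreover have "insert v C \<subset> S" "insert v D \<subset> S"
              using CD union join v by blast+
            \<comment> \<open>With n = \<open>card S\<close> these add up to 3e \<le> 8(n + 1) - 24
              = 8n - 16, which is three better than needed.\<close>
            ultimately have "3 * edges_in (insert v C) + 12 \<le> 8 * (1 + card C)"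
              "3 * edges_in (insert v D) + 12 \<le> 8 * (1 + card D)"
              using IH[of "insert v C"] IH[of "insert v D"] CD by simp_all
            moreover have "edges_in S \<le> edges_in (insert v C) + edges_in (insert v D)"
            proof -
              have S': "S = insert v C \<union> insert v D" using join union v by auto
              show ?thesis unfolding S' by (rule edges_in_Un_le) (use union in auto)
            qed
            moreover have "card S = 1 + card C + card D"
              using S A union CD by (simp add: card_Un_disjoint)
            ultimately show ?thesis by simp
          next
            case inner: (join C D)
            have CD: "finite C" "finite D" "v \<notin> C" "v \<notin> D" using inner fin join v by auto
            have B: "card B = card C + card D" using inner CD by (simp add: card_Un_disjoint)
            \<comment> \<open>Moving \<open>v\<close> to the smaller side regroups the join. Since
              \<open>D\<close> has at least three vertices, \<open>K\<^sub>3\<^sub>,\<^sub>3\<close>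
              forces \<open>insert v C\<close> to be a pair, which leads back to
              \<open>two\<close>.\<close>
            have edge: "{x, y} \<in> edges G" if "x \<in> insert v C" "y \<in> D" for x y
              using that join inner v by blast
            have "card (insert v C) = 1 + card C" using CD by simp
            moreover have "card C > 0" using CD inner by (simp add: card_gt_0_iff)
            moreover have "\<not> (3 \<le> card (insert v C) \<and> 3 \<le> card D)"
              using no_K33_ge[of "insert v C" D] edge by blast
            ultimately have "card (insert v C) = 2" using B S A 3 inner(4) by linarith
            moreover have "S = insert v C \<union> D" "insert v C \<inter> D = {}"
              using join inner v CD by auto
            ultimately show ?thesis using two[of "insert v C" D] edge by blast
          qed
        qed
      qed
      then show ?thesis by simp
    qed
  qed
  then show "3 * edges_in S + 12 \<le> 8 * card S" "card S \<ge> 7 \<Longrightarrow> 3 * edges_in S + 13 \<le> 8 * card S" by auto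
qed

end

section \<open>Extremal graphs\<close>

text \<open>As no vertex is isolated, a vertex on a foreign edge shows up as a bad meeting of two
  edges. Hence only pairs of edges have to be checked.\<close>

lemma planar_graph_straight_line:
  fixes p :: "'a \<Rightarrow> complex"
  assumes G: "simple_graph G" and inj: "inj_on p (vertices G)"
    and cover: "\<And>v. v \<in> vertices G \<Longrightarrow> \<exists>e\<in>edges G. v \<in> e"
    and meet: "\<And>e f. e \<in> edges G \<Longrightarrow> f \<in> edges G \<Longrightarrow> e \<noteq> f \<Longrightarrow>
      convex hull (p ` e) \<inter> convex hull (p ` f) \<subseteq> p ` (e \<inter> f)"
  shows "planar_graph G"
proof -
  have sub: "e \<subseteq> vertices G" if "e \<in> edges G" for e
    using G that by (auto simp: simple_graph_def nsets_def)
  have "\<exists>g. arc g \<and> {pathstart g, pathfinish g} = p ` e \<and> path_image g = convex hull (p ` e)"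
    if e: "e \<in> edges G" for e
  proof -
    obtain u v where uv: "e = {u, v}" "u \<in> vertices G" "v \<in> vertices G" "u \<noteq> v"
      using e by (rule simple_graph_edgeE[OF G])
    then have "p u \<noteq> p v" using inj by (auto simp: inj_on_def)
    then show ?thesis
      using uv(1) by (intro exI[of _ "linepath (p u) (p v)"]) (simp add: segment_convex_hull)
  qed
  then obtain \<gamma> where \<gamma>: "\<And>e. e \<in> edges G \<Longrightarrow> arc (\<gamma> e) \<and>
      {pathstart (\<gamma> e), pathfinish (\<gamma> e)} = p ` e \<and> path_image (\<gamma> e) = convex hull (p ` e)"
    by metis
  have "plane_drawing G p \<gamma>"
  proof (rule plane_drawingI[OF inj sub])
    show "w \<in> e" if e: "e \<in> edges G" and w: "w \<in> vertices G" "p w \<in> path_image (\<gamma> e)" for e w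
    proof -
      obtain f where f: "f \<in> edges G" "w \<in> f" using cover w by blast
      have "p w \<in> convex hull (p ` f)" using f by (intro hull_inc) auto
      then have "p w \<in> p ` e" if "e \<noteq> f"
        using meet[OF e f(1) that] w \<gamma>[OF e] by auto
      then show ?thesis using f inj w sub[OF e] by (auto simp: inj_on_def)
    qed
  qed (use \<gamma> meet in auto)
  then show ?thesis unfolding planar_graph_def by blast
qed

text \<open>The line where \<open>inner c\<close> equals t separates the segments: the first lies
  weakly on one side, and the second can touch the line only at x, which then is a common
  end.\<close>

lemma segments_meet_functional:
  fixes p :: "'a \<Rightarrow> 'b::real_inner"
  assumes "inner c (p u) \<le> t" "inner c (p v) \<le> t" "t \<le> inner c (p x)" "t < inner c (p y)"
    and x: "inner c (p x) = t \<Longrightarrow> x \<in> {u, v}"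
  shows "convex hull (p ` {u, v}) \<inter> convex hull (p ` {x, y}) \<subseteq> p ` ({u, v} \<inter> {x, y})"
proof
  fix z assume z: "z \<in> convex hull (p ` {u, v}) \<inter> convex hull (p ` {x, y})"
  have "convex hull (p ` {u, v}) \<subseteq> {z. inner c z \<le> t}"
    using assms(1,2) by (intro hull_minimal) (auto simp: convex_halfspace_le)
  then have le: "inner c z \<le> t" using z by auto
  have "z \<in> closed_segment (p x) (p y)" using z by (simp add: segment_convex_hull)
  then obtain s where s: "0 \<le> s" "s \<le> 1" "z = (1 - s) *\<^sub>R p x + s *\<^sub>R p y"
    by (auto simp: closed_segment_def)
  then have "inner c z = inner c (p x) + s * (inner c (p y) - inner c (p x))"
    unfolding s(3) by (simp add: inner_add_right algebra_simps)
  moreover have "s * (inner c (p y) - t) + (1 - s) * (inner c (p x) - t) = inner c z - t"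
    using calculation by (simp add: algebra_simps)
  moreover have "0 \<le> s * (inner c (p y) - t)" "0 \<le> (1 - s) * (inner c (p x) - t)"
    using s assms by simp_all
  \<comment> \<open>Two nonnegative terms with sum at most 0 vanish; as y lies strictly beyond the
    line, s = 0.\<close>
  ultimately have "s * (inner c (p y) - t) = 0" "(1 - s) * (inner c (p x) - t) = 0"
    using le by linarith+
  then have "s = 0" "inner c (p x) = t" using assms by auto
  then show "z \<in> p ` ({u, v} \<inter> {x, y})" using s x by auto
qed

text \<open>The sign of \<open>orient X Y u v w\<close> tells on which side of the line \<open>uv\<close> the point \<open>w\<close> lies.\<close>

definition orient :: "('a \<Rightarrow> int) \<Rightarrow> ('a \<Rightarrow> int) \<Rightarrow> 'a \<Rightarrow> 'a \<Rightarrow> 'a \<Rightarrow> int" where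
  "orient X Y u v w = (X v - X u) * (Y w - Y u) - (Y v - Y u) * (X w - X u)"

text \<open>A certificate in integer arithmetic, hence evaluable, that the line uv keeps the
  segments apart except at a shared end x. It treats the two segments, and x and y,
  asymmetrically.\<close>

definition one_sided :: "('a \<Rightarrow> int) \<Rightarrow> ('a \<Rightarrow> int) \<Rightarrow> 'a \<Rightarrow> 'a \<Rightarrow> 'a \<Rightarrow> 'a \<Rightarrow> bool" where
  "one_sided X Y u v x y \<longleftrightarrow>
     (orient X Y u v x > 0 \<or> orient X Y u v x = 0 \<and> (x = u \<or> x = v)) \<and> orient X Y u v y > 0 \<or>
     (orient X Y u v x < 0 \<or> orient X Y u v x = 0 \<and> (x = u \<or> x = v)) \<and> orient X Y u v y < 0"

lemma one_sided_segments_meet: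
  fixes X Y :: "'a \<Rightarrow> int"
  defines "p \<equiv> \<lambda>v. Complex (of_int (X v)) (of_int (Y v))"
  assumes "one_sided X Y u v x y"
  shows "convex hull (p ` {u, v}) \<inter> convex hull (p ` {x, y}) \<subseteq> p ` ({u, v} \<inter> {x, y})"
proof -
  \<comment> \<open>\<open>c\<close> is the vector from u to v turned by a right angle, so
    \<open>inner c\<close> measures the signed distance from the line uv up to scaling.\<close>
  define c where "c = Complex (of_int (Y u - Y v)) (of_int (X v - X u))"
  have o: "inner c (p w) - inner c (p u) = of_int (orient X Y u v w)" for w
    by (simp add: c_def p_def orient_def inner_complex_def algebra_simps)
  have v: "inner c (p v) = inner c (p u)"
    using o[of v] by (simp add: orient_def algebra_simps)
  show ?thesis
    using assms(2) unfolding one_sided_def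
  proof (elim disjE conjE)
    assume "orient X Y u v x > 0" "orient X Y u v y > 0"
    then show ?thesis
      using o[of x] o[of y] v
      by (intro segments_meet_functional[of c p u "inner c (p u)"]) (auto simp: algebra_simps)
  next
    assume "orient X Y u v x = 0" "x = u" "orient X Y u v y > 0"
    then show ?thesis
      using o[of x] o[of y] v
      by (intro segments_meet_functional[of c p u "inner c (p u)"]) (auto simp: algebra_simps)
  next
    assume "orient X Y u v x = 0" "x = v" "orient X Y u v y > 0"
    then show ?thesis
      using o[of x] o[of y] v
      by (intro segments_meet_functional[of c p u "inner c (p u)"]) (auto simp: algebra_simps)
  next
    assume "orient X Y u v x < 0" "orient X Y u v y < 0"
    then show ?thesis
      using o[of x] o[of y] v
      by (intro segments_meet_functional[of "- c" p u "- inner c (p u)"]) (auto simp: algebra_simps)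
  next
    assume "orient X Y u v x = 0" "x = u" "orient X Y u v y < 0"
    then show ?thesis
      using o[of x] o[of y] v
      by (intro segments_meet_functional[of "- c" p u "- inner c (p u)"]) (auto simp: algebra_simps)
  next
    assume "orient X Y u v x = 0" "x = v" "orient X Y u v y < 0"
    then show ?thesis
      using o[of x] o[of y] v
      by (intro segments_meet_functional[of "- c" p u "- inner c (p u)"]) (auto simp: algebra_simps)
  qed
qed

text \<open>The antipodal pairs are \<open>{0, 1}\<close>, \<open>{2, 3}\<close> and \<open>{4, 5}\<close>.\<close>

definition octahedron_pairs :: "(nat \<times> nat) list" where
  "octahedron_pairs = [(0, 2), (0, 3), (0, 4), (0, 5), (1, 2), (1, 3), (1, 4), (1, 5),
     (2, 4), (2, 5), (3, 4), (3, 5)]"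

definition octahedron :: "nat sgraph" where
  "octahedron = ({..<6}, (\<lambda>(u, v). {u, v}) ` set octahedron_pairs)"

text \<open>Vertices 0, 2, 4 form the outer triangle. Their antipodes 1, 3, 5 form a small inverted
  triangle inside, each close to the outer side opposite its antipode.\<close>

definition oct_X :: "nat \<Rightarrow> int" where "oct_X v = [0, 0, -6, 1, 6, -1] ! v"

definition oct_Y :: "nat \<Rightarrow> int" where "oct_Y v = [6, -1, -3, 1, -3, 1] ! v"

lemma simple_graph_octahedron: "simple_graph octahedron"
  by (auto simp: simple_graph_def octahedron_def octahedron_pairs_def)

lemma planar_graph_octahedron: "planar_graph octahedron"
proof (rule planar_graph_straight_line[OF simple_graph_octahedron,
      where p = "\<lambda>v. Complex (of_int (oct_X v)) (of_int (oct_Y v))"])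
  let ?p = "\<lambda>v. Complex (of_int (oct_X v)) (of_int (oct_Y v))"
  have V: "vertices octahedron = {0, 1, 2, 3, 4, 5}"
    by (auto simp: octahedron_def)
  show "inj_on ?p (vertices octahedron)"
    unfolding V by (simp add: inj_on_def oct_X_def oct_Y_def)
  show "\<exists>e\<in>edges octahedron. v \<in> e" if "v \<in> vertices octahedron" for v
    using that unfolding V by (auto simp: octahedron_def octahedron_pairs_def)
  \<comment> \<open>Either segment may supply the line and either end of the other may touch it,
    hence four variants.\<close>
  have check: "list_all (\<lambda>(u, v). list_all (\<lambda>(x, y). (u, v) = (x, y) \<or>
      one_sided oct_X oct_Y u v x y \<or> one_sided oct_X oct_Y u v y x \<or>
      one_sided oct_X oct_Y x y u v \<or> one_sided oct_X oct_Y x y v u) octahedron_pairs) octahedron_pairs"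
    by code_simp
  fix e f assume "e \<in> edges octahedron" "f \<in> edges octahedron" and ne: "e \<noteq> f"
  then obtain u v x y where e: "(u, v) \<in> set octahedron_pairs" "e = {u, v}"
    and f: "(x, y) \<in> set octahedron_pairs" "f = {x, y}"
    by (auto simp: octahedron_def)
  then consider "one_sided oct_X oct_Y u v x y" | "one_sided oct_X oct_Y u v y x" |
      "one_sided oct_X oct_Y x y u v" | "one_sided oct_X oct_Y x y v u"
    using check[unfolded list_all_iff, THEN bspec, OF e(1), unfolded prod.case, THEN bspec, OF f(1)] ne
    by auto
  then show "convex hull (?p ` e) \<inter> convex hull (?p ` f) \<subseteq> ?p ` (e \<inter> f)"
  proof cases
    case 1
    then show ?thesis unfolding e f by (rule one_sided_segments_meet)
  next
    case 2
    then show ?thesis unfolding e f insert_commute[of x y] by (rule one_sided_segments_meet)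
  next
    case 3
    then have "convex hull (?p ` f) \<inter> convex hull (?p ` e) \<subseteq> ?p ` (f \<inter> e)"
      unfolding e f by (rule one_sided_segments_meet)
    then show ?thesis by (simp only: Int_commute)
  next
    case 4
    then have "convex hull (?p ` f) \<inter> convex hull (?p ` e) \<subseteq> ?p ` (f \<inter> e)"
      unfolding e f insert_commute[of u v] by (rule one_sided_segments_meet)
    then show ?thesis by (simp only: Int_commute)
  qed
qed

lemma card_edges_octahedron: "card (edges octahedron) = 12"
proof -
  have "inj_on (\<lambda>(u, v). {u, v}) (set octahedron_pairs)"
    by (auto simp: inj_on_def octahedron_pairs_def doubleton_eq_iff)
  then have "card (edges octahedron) = card (set octahedron_pairs)"
    by (simp add: octahedron_def card_image)
  then show ?thesis by (simp add: octahedron_pairs_def)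
qed

text \<open>Distinct nonadjacent vertices form an antipodal pair, but in an induced path a is
  nonadjacent to both c and d.\<close>

lemma octahedron_P4_free: "\<not> induced_P4 octahedron a b c d"
proof
  assume P: "induced_P4 octahedron a b c d"
  have E: "{u, v} \<in> edges octahedron \<longleftrightarrow> u < 6 \<and> v < 6 \<and> u div 2 \<noteq> v div 2" for u v
  proof -
    have "{u, v} \<in> edges octahedron \<longleftrightarrow> (u, v) \<in> set octahedron_pairs \<or> (v, u) \<in> set octahedron_pairs"
      by (auto simp: octahedron_def doubleton_eq_iff image_iff)
    also have "\<dots> \<longleftrightarrow> u < 6 \<and> v < 6 \<and> u div 2 \<noteq> v div 2"
    proof (cases "u < 6 \<and> v < 6")
      case True
      have "list_all (\<lambda>u. list_all (\<lambda>v. ((u, v) \<in> set octahedron_pairs \<or>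
          (v, u) \<in> set octahedron_pairs) = (u div 2 \<noteq> v div 2)) [0..<6]) [0..<6]"
        by code_simp
      then show ?thesis using True by (simp only: list_all_iff set_upt) simp
    qed (auto simp: octahedron_pairs_def)
    finally show ?thesis .
  qed
  have "a < 6" "b < 6" "c < 6" "d < 6" "a div 2 = c div 2" "a div 2 = d div 2" "distinct [a, b, c, d]"
    using P by (auto simp: induced_P4_def E)
  then show False by simp linarith
qed

text \<open>The vertices \<open>m\<close> and \<open>Suc m\<close> are adjacent to everything; cutting the path on \<open>{..<m}\<close> after
  every third vertex leaves copies of \<open>P\<^sub>3\<close>.\<close>

definition joined_paths_edges :: "nat \<Rightarrow> nat set set" where
  "joined_paths_edges m = (\<lambda>i. {i, Suc i}) ` {i. Suc i < m \<and> i mod 3 \<noteq> 2} \<union>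
     (\<lambda>i. {i, m}) ` {..<m} \<union> (\<lambda>i. {i, Suc m}) ` {..<m} \<union> {{m, Suc m}}"

definition joined_paths :: "nat \<Rightarrow> nat sgraph" where
  "joined_paths m = ({..<m + 2}, joined_paths_edges m)"

lemma simple_graph_joined_paths: "simple_graph (joined_paths m)"
  by (auto simp: simple_graph_def joined_paths_def joined_paths_edges_def)

text \<open>The path vertices sit on the x-axis from 1 onwards, with \<open>m\<close> and
  \<open>Suc m\<close> above and below the origin. The edges to these two form fans in opposite half
  planes, and the edge between them runs along the y-axis, which the shift by 1 keeps clear.\<close>

lemma planar_graph_joined_paths:
  assumes "m \<ge> 1"
  shows "planar_graph (joined_paths m)"
proof -
  define X where "X v = (if v < m then int v + 1 else 0)" for v
  define Y where "Y v = (if v < m then 0 else if v = m then 1 else - 1 :: int)" for v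
  let ?p = "\<lambda>v. Complex (of_int (X v)) (of_int (Y v))"
  let ?S = "\<lambda>e. convex hull (?p ` e)"
  have XY [simp]: "v < m \<Longrightarrow> X v = int v + 1" "v < m \<Longrightarrow> Y v = 0"
    "X m = 0" "Y m = 1" "X (Suc m) = 0" "Y (Suc m) = - 1" for v
    by (simp_all add: X_def Y_def)
  define meets where "meets e f \<longleftrightarrow> ?S e \<inter> ?S f \<subseteq> ?p ` (e \<inter> f)" for e f
  have sym: "meets e f \<longleftrightarrow> meets f e" for e f
    unfolding meets_def by (simp add: Int_commute)
  have os: "meets {u, v} {x, y}" if "one_sided X Y u v x y" for u v x y
    unfolding meets_def using that by (rule one_sided_segments_meet)
  have os': "meets {u, v} {x, y}" if "one_sided X Y u v y x" for u v x y
    using os[OF that] by (simp add: insert_commute)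
  \<comment> \<open>Collinear segments have no usable orientation; they are separated by the
    x-coordinate instead, at that of \<open>Suc i\<close>.\<close>
  have PP: "meets {i, Suc i} {j, Suc j}" if "i < j" "Suc j < m" for i j
    unfolding meets_def
    by (rule segments_meet_functional[of 1 _ _ "real i + 2"]) (use that in \<open>auto simp: inner_complex_def\<close>)
  have Pm: "meets {i, m} {j, Suc j}" if "i < m" "Suc j < m" for i j
  proof (cases "i \<le> j")
    case True
    show ?thesis by (rule os) (use that True in \<open>auto simp: one_sided_def orient_def algebra_simps\<close>)
  next
    case False
    show ?thesis by (rule os') (use that False in \<open>auto simp: one_sided_def orient_def algebra_simps\<close>)
  qed
  have Pn: "meets {i, Suc m} {j, Suc j}" if "i < m" "Suc j < m" for i j
  proof (cases "i \<le> j")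
    case True
    show ?thesis by (rule os) (use that True in \<open>auto simp: one_sided_def orient_def algebra_simps\<close>)
  next
    case False
    show ?thesis by (rule os') (use that False in \<open>auto simp: one_sided_def orient_def algebra_simps\<close>)
  qed
  have PC: "meets {m, Suc m} {j, Suc j}" if "Suc j < m" for j
    by (rule os) (use that in \<open>auto simp: one_sided_def orient_def algebra_simps\<close>)
  have mC: "meets {m, Suc m} {j, m}" if "j < m" for j
    by (rule os') (use that in \<open>auto simp: one_sided_def orient_def algebra_simps\<close>)
  have nC: "meets {m, Suc m} {j, Suc m}" if "j < m" for j
    by (rule os') (use that in \<open>auto simp: one_sided_def orient_def algebra_simps\<close>)
  have mm: "meets {i, m} {j, m}" if "i < m" "j < m" "i \<noteq> j" for i j
    by (rule os') (use that in \<open>auto simp: one_sided_def orient_def algebra_simps\<close>)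
  have nn: "meets {i, Suc m} {j, Suc m}" if "i < m" "j < m" "i \<noteq> j" for i j
    by (rule os') (use that in \<open>auto simp: one_sided_def orient_def algebra_simps\<close>)
  \<comment> \<open>The line is taken through the outer of the two path vertices; the other segment
    lies on the origin's side of it, up to the common end when i = j.\<close>
  have mn: "meets {i, m} {j, Suc m}" if "i < m" "j < m" for i j
  proof (cases "i < j")
    case True
    have "meets {j, Suc m} {i, m}"
      by (rule os) (use that True in \<open>auto simp: one_sided_def orient_def algebra_simps\<close>)
    then show ?thesis using sym by simp
  next
    case False
    show ?thesis by (rule os) (use that False in \<open>auto simp: one_sided_def orient_def algebra_simps\<close>)
  qed
  show ?thesis
  proof (rule planar_graph_straight_line[OF simple_graph_joined_paths, where p = ?p])
    show "inj_on ?p (vertices (joined_paths m))"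
      by (auto simp: inj_on_def joined_paths_def X_def Y_def split: if_splits)
    show "\<exists>e\<in>edges (joined_paths m). v \<in> e" if "v \<in> vertices (joined_paths m)" for v
    proof (cases "v < m")
      case True
      then show ?thesis by (auto simp: joined_paths_def joined_paths_edges_def)
    next
      case False
      then have "v \<in> {m, Suc m}" using that by (auto simp: joined_paths_def)
      then show ?thesis by (auto simp: joined_paths_def joined_paths_edges_def)
    qed
    have "meets e f" if "e \<in> edges (joined_paths m)" "f \<in> edges (joined_paths m)" "e \<noteq> f" for e f
    proof -
      have symD: "meets e f" if "meets f e" for e f using that sym by blast
      have PP': "meets {i, Suc i} {j, Suc j}" if "Suc i < m" "Suc j < m" "i \<noteq> j" for i j
      proof (cases "i < j")
        case True
        then show ?thesis using PP that by blast
      next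
        case False
        then have "j < i" using that by simp
        then show ?thesis using PP[of j i] that symD by blast
      qed
      define P where "P = (\<lambda>i. {i, Suc i}) ` {i. Suc i < m \<and> i mod 3 \<noteq> 2}"
      define M where "M = (\<lambda>i. {i, m}) ` {..<m}"
      define N where "N = (\<lambda>i. {i, Suc m}) ` {..<m}"
      define C where "C = {{m, Suc m}}"
      have P: thesis if "e \<in> P" "\<And>i. e = {i, Suc i} \<Longrightarrow> Suc i < m \<Longrightarrow> thesis" for e thesis
        using that unfolding P_def by (elim imageE CollectE conjE) blast
      have M: thesis if "e \<in> M" "\<And>i. e = {i, m} \<Longrightarrow> i < m \<Longrightarrow> thesis" for e thesis
        using that unfolding M_def by (elim imageE) simp
      have N: thesis if "e \<in> N" "\<And>i. e = {i, Suc m} \<Longrightarrow> i < m \<Longrightarrow> thesis" for e thesis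
        using that unfolding N_def by (elim imageE) simp
      have C: "e = {m, Suc m}" if "e \<in> C" for e using that by (simp add: C_def)
      have "meets e f" if "e \<in> P" "f \<in> P" "e \<noteq> f" for e f
        by (rule P[OF that(1)], rule P[OF that(2)]) (metis PP' that(3))
      moreover have "meets e f" if "e \<in> M" "f \<in> M" "e \<noteq> f" for e f
        by (rule M[OF that(1)], rule M[OF that(2)]) (metis mm that(3))
      moreover have "meets e f" if "e \<in> N" "f \<in> N" "e \<noteq> f" for e f
        by (rule N[OF that(1)], rule N[OF that(2)]) (metis nn that(3))
      moreover have "meets e f" if "e \<in> M" "f \<in> P" for e f
        by (rule M[OF that(1)], rule P[OF that(2)]) (simp add: Pm)
      moreover have "meets e f" if "e \<in> N" "f \<in> P" for e f
        by (rule N[OF that(1)], rule P[OF that(2)]) (simp add: Pn)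
      moreover have "meets e f" if "e \<in> C" "f \<in> P" for e f
        by (rule P[OF that(2)]) (simp add: PC C[OF that(1)])
      moreover have "meets e f" if "e \<in> M" "f \<in> N" for e f
        by (rule M[OF that(1)], rule N[OF that(2)]) (simp add: mn)
      moreover have "meets e f" if "e \<in> C" "f \<in> M" for e f
        by (rule M[OF that(2)]) (simp add: mC C[OF that(1)])
      moreover have "meets e f" if "e \<in> C" "f \<in> N" for e f
        by (rule N[OF that(2)]) (simp add: nC C[OF that(1)])
      moreover have "e \<in> P \<or> e \<in> M \<or> e \<in> N \<or> e \<in> C" if "e \<in> edges (joined_paths m)" for e
        using that unfolding joined_paths_def joined_paths_edges_def snd_conv Un_iff
          P_def[symmetric] M_def[symmetric] N_def[symmetric] C_def[symmetric] by blast
      moreover have "e = f" if "e \<in> C" "f \<in> C" using C[OF that(1)] C[OF that(2)] by simp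
      ultimately show ?thesis using that symD by metis
    qed
    then show "?S e \<inter> ?S f \<subseteq> ?p ` (e \<inter> f)"
      if "e \<in> edges (joined_paths m)" "f \<in> edges (joined_paths m)" "e \<noteq> f" for e f
      using that unfolding meets_def by blast
  qed
qed

text \<open>A full block of three vertices carries two edges, and a last block of one or two
  vertices carries none or one.\<close>

lemma card_path_indices: "card {i. Suc i < m \<and> i mod 3 \<noteq> 2} = 2 * m div 3"
proof (induction m)
  case 0
  then show ?case by simp
next
  case (Suc m)
  show ?case
  proof (cases m)
    case (Suc k)
    have "{i. Suc i < Suc m \<and> i mod 3 \<noteq> 2} =
        (if k mod 3 \<noteq> 2 then insert k else id) {i. Suc i < m \<and> i mod 3 \<noteq> 2}"
      unfolding Suc by (auto simp: less_Suc_eq)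
    moreover have "finite {i. Suc i < m \<and> i mod 3 \<noteq> 2}" by (rule finite_subset[of _ "{..<m}"]) auto
    ultimately have "card {i. Suc i < Suc m \<and> i mod 3 \<noteq> 2} = 2 * m div 3 + (if k mod 3 \<noteq> 2 then 1 else 0)"
      using Suc.IH Suc by simp
    also have "\<dots> = 2 * Suc m div 3"
      unfolding Suc by presburger
    finally show ?thesis .
  qed simp
qed

lemma card_edges_joined_paths: "card (edges (joined_paths m)) = 2 * m div 3 + 2 * m + 1"
proof -
  let ?I = "{i. Suc i < m \<and> i mod 3 \<noteq> 2}"
  have fin: "finite ?I" by (rule finite_subset[of _ "{..<m}"]) auto
  have "card ((\<lambda>i. {i, Suc i}) ` ?I) = 2 * m div 3"
    by (subst card_image) (auto simp: inj_on_def doubleton_eq_iff card_path_indices)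
  moreover have "card ((\<lambda>i. {i, m}) ` {..<m}) = m"
    by (subst card_image) (auto simp: inj_on_def doubleton_eq_iff)
  moreover have "card ((\<lambda>i. {i, Suc m}) ` {..<m}) = m"
    by (subst card_image) (auto simp: inj_on_def doubleton_eq_iff)
  moreover have "((\<lambda>i. {i, Suc i}) ` ?I) \<inter> ((\<lambda>i. {i, m}) ` {..<m}) = {}"
    "((\<lambda>i. {i, Suc i}) ` ?I \<union> (\<lambda>i. {i, m}) ` {..<m}) \<inter> ((\<lambda>i. {i, Suc m}) ` {..<m}) = {}"
    "{m, Suc m} \<notin> (\<lambda>i. {i, Suc i}) ` ?I \<union> (\<lambda>i. {i, m}) ` {..<m} \<union> (\<lambda>i. {i, Suc m}) ` {..<m}"
    by (auto simp: doubleton_eq_iff)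
  ultimately show ?thesis
    unfolding joined_paths_def joined_paths_edges_def using fin
    by (simp add: card_Un_disjoint)
qed

text \<open>Each vertex of an induced path on four vertices misses another one, which excludes
  \<open>m\<close> and \<open>Suc m\<close>; by connectedness the path would lie in a single block
  of three integers.\<close>

lemma joined_paths_P4_free: "\<not> induced_P4 (joined_paths m) a b c d"
proof
  assume P: "induced_P4 (joined_paths m) a b c d"
  let ?E = "edges (joined_paths m)"
  have V: "u < m + 2 \<and> v < m + 2" if "{u, v} \<in> ?E" for u v
    using edge_doubleton(1,2)[OF simple_graph_joined_paths that] by (simp add: joined_paths_def)
  have uni: "{u, v} \<in> ?E" if "u \<ge> m \<or> v \<ge> m" "u < m + 2" "v < m + 2" "u \<noteq> v" for u v
  proof -
    have "u < m \<or> u = m \<or> u = Suc m" "v < m \<or> v = m \<or> v = Suc m" using that by auto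
    then show ?thesis
      using that by (elim disjE) (auto simp: joined_paths_def joined_paths_edges_def insert_commute)
  qed
  have block: "u div 3 = v div 3" if "{u, v} \<in> ?E" "u < m" "v < m" for u v
  proof -
    have "{u, v} \<notin> (\<lambda>i. {i, m}) ` {..<m}" "{u, v} \<notin> (\<lambda>i. {i, Suc m}) ` {..<m}" "{u, v} \<noteq> {m, Suc m}"
      using that by (auto simp: doubleton_eq_iff)
    then have "{u, v} \<in> (\<lambda>i. {i, Suc i}) ` {i. Suc i < m \<and> i mod 3 \<noteq> 2}"
      using that(1) unfolding joined_paths_def joined_paths_edges_def snd_conv Un_iff singleton_iff
      by blast
    then obtain i where "{u, v} = {i, Suc i}" "i mod 3 \<noteq> 2"
      by auto
    then show ?thesis by (auto simp: doubleton_eq_iff) presburger+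
  qed
  have lt: "a < m + 2" "b < m + 2" "c < m + 2" "d < m + 2" "distinct [a, b, c, d]"
    using P V unfolding induced_P4_def by blast+
  have ne: "a \<noteq> c" "b \<noteq> d" using lt(5) by auto
  have non: "{a, c} \<notin> ?E" "{b, d} \<notin> ?E" using P unfolding induced_P4_def by blast+
  \<comment> \<open>The nonadjacent pairs ac and bd already cover all four vertices.\<close>
  have "a < m" "b < m" "c < m" "d < m"
    using uni[OF _ lt(1,3) ne(1)] uni[OF _ lt(2,4) ne(2)] non by (meson not_le)+
  then have "a div 3 = b div 3" "b div 3 = c div 3" "c div 3 = d div 3"
    using P block unfolding induced_P4_def by blast+
  then have eq: "a div 3 = d div 3" "b div 3 = d div 3" "c div 3 = d div 3" "d div 3 = d div 3"
    by simp_all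
  have "x \<in> {3 * k..<3 * k + 3}" if "x div 3 = k" for x k :: nat
    using that by auto
  note this[OF eq(1)] this[OF eq(2)] this[OF eq(3)] this[OF eq(4)]
  then have "{a, b, c, d} \<subseteq> {3 * (d div 3)..<3 * (d div 3) + 3}" by (simp only: insert_subset empty_subsetI)
  then have "card {a, b, c, d} \<le> 3" using card_mono[OF finite_atLeastLessThan, of "{a, b, c, d}"] by fastforce
  then show False using lt(5) by simp
qed

section \<open>The extremal numbers\<close>

lemma ex_planar_ind_eqI:
  assumes "simple_graph (G :: nat sgraph)" "card (vertices G) = n" "planar_graph G" "induced_free F G"
    and "\<And>H :: nat sgraph. simple_graph H \<Longrightarrow> card (vertices H) = n \<Longrightarrow> planar_graph H \<Longrightarrow>
      induced_free F H \<Longrightarrow> card (edges H) \<le> card (edges G)"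
  shows "ex_planar_ind n F = card (edges G)"
  unfolding ex_planar_ind_def
proof (rule Max_eqI[OF finite_ex_planar_ind_edge_counts])
  show "card (edges G) \<in> ex_planar_ind_edge_counts n F"
    unfolding ex_planar_ind_edge_counts_def using assms(1-4) by blast
  show "k \<le> card (edges G)" if "k \<in> ex_planar_ind_edge_counts n F" for k
    using that assms(5) unfolding ex_planar_ind_edge_counts_def by blast
qed

lemma planar_P4_free_card_edges:
  assumes "simple_graph G" "planar_graph G" "induced_free (path_graph 4) G" "card (vertices G) \<ge> 3"
  shows "card (vertices G) \<le> 6 \<Longrightarrow> card (edges G) + 6 \<le> 3 * card (vertices G)"
    and "card (vertices G) \<ge> 7 \<Longrightarrow> 3 * card (edges G) + 13 \<le> 8 * card (vertices G)"
proof -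
  obtain p \<gamma> where "plane_drawing G p \<gamma>" using assms unfolding planar_graph_def by blast
  then interpret P4_free_drawing G p \<gamma>
    using assms induced_free_P4_iff[OF assms(1)] by unfold_locales auto
  have "{f \<in> edges G. f \<subseteq> vertices G} = edges G"
    using simple by (auto simp: simple_graph_def nsets_def)
  then have "edges_in (vertices G) = card (edges G)" by (simp add: edges_in_def)
  then show "card (vertices G) \<le> 6 \<Longrightarrow> card (edges G) + 6 \<le> 3 * card (vertices G)"
    "card (vertices G) \<ge> 7 \<Longrightarrow> 3 * card (edges G) + 13 \<le> 8 * card (vertices G)"
    using edges_in_le_small[OF finite_vertices] edges_in_le(2)[OF finite_vertices] assms(4) by auto
qed

text \<open>For n = 3, 4, 5 the value is 3, 6, 9, which agrees with 3n - 6, so the same graphs are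
  extremal there. At n = 6 it would be 11, one less than the octahedron has.\<close>

lemma ex_planar_ind_P4_joined_paths:
  assumes "n \<ge> 3" "n \<noteq> 6"
  shows "ex_planar_ind n (path_graph 4) = 2 * (n - 2) div 3 + 2 * (n - 2) + 1"
  unfolding card_edges_joined_paths[symmetric]
proof (rule ex_planar_ind_eqI)
  show "card (vertices (joined_paths (n - 2))) = n"
    using assms by (simp add: joined_paths_def)
  show "planar_graph (joined_paths (n - 2))"
    using assms by (intro planar_graph_joined_paths) simp
  show "induced_free (path_graph 4) (joined_paths (n - 2))"
    using induced_free_P4_iff[OF simple_graph_joined_paths] joined_paths_P4_free by blast
  show "card (edges H) \<le> card (edges (joined_paths (n - 2)))"
    if "simple_graph H" "card (vertices H) = n" "planar_graph H" "induced_free (path_graph 4) H"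
    for H :: "nat sgraph"
  proof (cases "n \<le> 6")
    case True
    then have "card (edges H) + 6 \<le> 3 * n"
      using planar_P4_free_card_edges(1)[OF that(1,3,4)] that(2) assms by simp
    moreover have "n = 3 \<or> n = 4 \<or> n = 5" using True assms by auto
    ultimately show ?thesis unfolding card_edges_joined_paths by auto
  next
    case False
    define k where "k = n - 2"
    have "3 * card (edges H) \<le> 8 * k + 3"
      using planar_P4_free_card_edges(2)[OF that(1,3,4)] that(2) False by (simp add: k_def)
    \<comment> \<open>Integrality turns the bound into the floor of 8k/3 plus 1, and 8k/3 = 2k +
      2k/3.\<close>
    then show ?thesis unfolding card_edges_joined_paths k_def[symmetric] by linarith
  qed
qed (rule simple_graph_joined_paths)

lemma ex_planar_ind_P4_six: "ex_planar_ind 6 (path_graph 4) = 12"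
  unfolding card_edges_octahedron[symmetric]
proof (rule ex_planar_ind_eqI)
  show "card (vertices octahedron) = 6" by (simp add: octahedron_def)
  show "induced_free (path_graph 4) octahedron"
    using induced_free_P4_iff[OF simple_graph_octahedron] octahedron_P4_free by blast
  show "card (edges H) \<le> card (edges octahedron)"
    if "simple_graph H" "card (vertices H) = 6" "planar_graph H" "induced_free (path_graph 4) H"
    for H :: "nat sgraph"
    using planar_P4_free_card_edges[OF that(1,3,4)] that(2) by (simp add: card_edges_octahedron)
qed (rule simple_graph_octahedron planar_graph_octahedron)+

theorem theorem1p3:
  fixes n :: nat
  assumes "n \<ge> 3"
  shows "int (ex_planar_ind n (path_graph 4)) =
    (if n \<le> 6 then 3 * int n - 6 else \<lfloor>8 / 3 * (real n - 2)\<rfloor> + 1)"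
proof (cases "n = 6")
  case True
  then show ?thesis by (simp add: ex_planar_ind_P4_six)
next
  case False
  note ex = ex_planar_ind_P4_joined_paths[OF assms False]
  show ?thesis
  proof (cases "n \<le> 6")
    case True
    then have "n = 3 \<or> n = 4 \<or> n = 5" using assms False by auto
    then show ?thesis using ex by auto
  next
    case n: False
    have "8 / 3 * (real n - 2) = real_of_int (8 * int (n - 2)) / real_of_int 3"
      using assms by (simp add: of_nat_diff)
    then have "\<lfloor>8 / 3 * (real n - 2)\<rfloor> = 8 * int (n - 2) div 3"
      by (simp only: floor_divide_of_int_eq)
    moreover have "int (2 * (n - 2) div 3 + 2 * (n - 2) + 1) = 8 * int (n - 2) div 3 + 1"
      by presburger
    ultimately show ?thesis using ex n by simp
  qed
qed

end
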